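(* Let $G$ be a connected 4-regular graph and let $p$ be any prime. Let $v$ and $w$ be adjacent vertices of $G$ which have exactly two common neighbours. Then \[ c_2^{(p)}(G - v) = c_2^{(p)}(G - w), \] and thus $c_2(G - v) = c_2(G - w)$.
   Context: For a graph $H$, $H-v$ denotes the graph obtained by deleting the vertex $v$ and all edges incident to it. For a connected graph $H$ with at least $3$ vertices, assign a variable $\alpha_e$ to each edge $e$ and define the Kirchhoff polynomial $\Psi_H=\sum_{T}\prod_{e\notin T}\alpha_e$, the sum over all spanning trees $T$ of $H$. For a prime $p$, let $[\Psi_H]_p$ be the number of zeros of $\Psi_H$ in $\mathbb{F}_p^{|E(H)|}$; it is divisible by $p^2$, and $c_2^{(p)}(H)\equiv [\Psi_H]_p/p^2 \pmod p$, an element of $\mathbb{Z}/p\mathbb{Z}$. The $c_2$-invariant $c_2(H)$ denotes the sequence $(c_2^{(p)}(H))_p$ indexed by all primes $p$. *)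

theory Defs
  imports "HOL-Library.FuncSet" "HOL-Number_Theory.Cong"
begin

text \<open>
  Undirected multigraphs. Edges are abstract labels, so parallel edges are distinct elements
  of \<open>edges G\<close>; a loop at \<open>x\<close> is an edge \<open>e\<close> with \<open>ends G e = {x}\<close>.
\<close>

record ('v, 'e) multigraph =
  verts :: "'v set"
  edges :: "'e set"
  ends :: "'e \<Rightarrow> 'v set"

definition wf_graph :: "('v, 'e) multigraph \<Rightarrow> bool" where
  "wf_graph G \<longleftrightarrow> finite (verts G) \<and> finite (edges G) \<and>
     (\<forall>e\<in>edges G. \<exists>x\<in>verts G. \<exists>y\<in>verts G. ends G e = {x, y})"

text \<open>
  A walk from \<open>u\<close> is the list of its steps \<open>(e, x)\<close>: traverse the edge \<open>e\<close> and arrive at \<open>x\<close>.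
\<close>

fun walk :: "('v, 'e) multigraph \<Rightarrow> 'v \<Rightarrow> ('e \<times> 'v) list \<Rightarrow> 'v \<Rightarrow> bool" where
  "walk G u [] w \<longleftrightarrow> u \<in> verts G \<and> u = w"
| "walk G u ((e, x) # s) w \<longleftrightarrow>
     u \<in> verts G \<and> e \<in> edges G \<and> ends G e = {u, x} \<and> walk G x s w"

definition connected_graph :: "('v, 'e) multigraph \<Rightarrow> bool" where
  "connected_graph G \<longleftrightarrow> verts G \<noteq> {} \<and> (\<forall>u\<in>verts G. \<forall>w\<in>verts G. \<exists>s. walk G u s w)"

text \<open>
  A loop is a cycle of length 1 and a pair of parallel edges gives a cycle of length 2;
  distinctness of the edges rules out walking back and forth along one edge.
\<close>

definition is_cycle :: "('v, 'e) multigraph \<Rightarrow> 'v \<Rightarrow> ('e \<times> 'v) list \<Rightarrow> bool" where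
  "is_cycle G u s \<longleftrightarrow> s \<noteq> [] \<and> walk G u s u \<and> distinct (map fst s) \<and> distinct (map snd s)"

definition is_tree :: "('v, 'e) multigraph \<Rightarrow> bool" where
  "is_tree G \<longleftrightarrow> connected_graph G \<and> (\<nexists>u s. is_cycle G u s)"

definition spanning_trees :: "('v, 'e) multigraph \<Rightarrow> 'e set set" where
  "spanning_trees G = {T. T \<subseteq> edges G \<and> is_tree (G\<lparr>edges := T\<rparr>)}"

text \<open>A loop contributes 2 to the degree of its vertex.\<close>

definition degree :: "('v, 'e) multigraph \<Rightarrow> 'v \<Rightarrow> nat" where
  "degree G u = card {e \<in> edges G. u \<in> ends G e} + card {e \<in> edges G. ends G e = {u}}"

definition regular_graph :: "nat \<Rightarrow> ('v, 'e) multigraph \<Rightarrow> bool" where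
  "regular_graph d G \<longleftrightarrow> (\<forall>u\<in>verts G. degree G u = d)"

definition neighbours :: "('v, 'e) multigraph \<Rightarrow> 'v \<Rightarrow> 'v set" where
  "neighbours G u = {x. x \<noteq> u \<and> (\<exists>e\<in>edges G. ends G e = {u, x})}"

definition delete_vertex :: "('v, 'e) multigraph \<Rightarrow> 'v \<Rightarrow> ('v, 'e) multigraph" where
  "delete_vertex G v = G\<lparr>verts := verts G - {v}, edges := {e \<in> edges G. v \<notin> ends G e}\<rparr>"

text \<open>The Kirchhoff polynomial, as a polynomial function of the edge variables.\<close>

definition kirchhoff :: "('v, 'e) multigraph \<Rightarrow> ('e \<Rightarrow> 'a::comm_ring_1) \<Rightarrow> 'a" where
  "kirchhoff G \<alpha> = (\<Sum>T\<in>spanning_trees G. \<Prod>e\<in>edges G - T. \<alpha> e)"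

text \<open>
  The field with \<open>p\<close> elements is represented by the residues \<open>{0..<p}\<close>, and vanishing in it
  by congruence to 0 modulo \<open>p\<close>.
\<close>

definition point_count :: "nat \<Rightarrow> ('v, 'e) multigraph \<Rightarrow> nat" where
  "point_count p G =
     card {\<alpha> \<in> edges G \<rightarrow>\<^sub>E {0..<int p}. [kirchhoff G \<alpha> = 0] (mod int p)}"

text \<open>
  The element of the ring of integers modulo \<open>p\<close> is given by its representative in \<open>{0..<p}\<close>.
  For connected graphs with at least 3 vertices the division by \<open>p\<^sup>2\<close> is exact; the value is
  meaningful only for such graphs.
\<close>

definition c2_at :: "nat \<Rightarrow> ('v, 'e) multigraph \<Rightarrow> nat" where
  "c2_at p G = (point_count p G div p\<^sup>2) mod p"

definition c2 :: "('v, 'e) multigraph \<Rightarrow> nat \<Rightarrow> nat" where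
  "c2 G = (\<lambda>p\<in>{p. prime p}. c2_at p G)"

end

theory Submission
  imports Defs "HOL-Library.Multiset"
begin

text \<open>
  Let \<open>K = G - v - w\<close>, let \<open>a, b\<close> be the common neighbours and let \<open>y\<close> be the fourth neighbour of
  \<open>w\<close>, so that \<open>G - v\<close> is \<open>K\<close> with a vertex joined to \<open>a, b, y\<close>. With \<open>T\<close> the tree sum of \<open>K\<close>,
  \<open>f\<^sub>1\<^sub>3, f\<^sub>2\<^sub>3\<close> the sums over 2-forests separating \<open>a\<close> from \<open>y\<close> and \<open>b\<close> from \<open>y\<close>, \<open>f\<^sub>3\<close> the sum
  over 2-forests separating both \<open>a\<close> and \<open>b\<close> from \<open>y\<close>, and \<open>F\<close> the sum over 3-forests separating
  \<open>a, b, y\<close>, one has \<open>T F = f\<^sub>1\<^sub>3 f\<^sub>2\<^sub>3 - f\<^sub>3\<^sup>2\<close>. Hence the Kirchhoff polynomial is, in the three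
  variables at \<open>w\<close>, a nondegenerate quadratic cone or a linear form, with exactly \<open>p\<^sup>2\<close> zeros, unless
  \<open>T = f\<^sub>1\<^sub>3 = f\<^sub>2\<^sub>3 = 0\<close>. So the invariant is, modulo \<open>p\<close>, minus the number of common zeros of
  \<open>T, f\<^sub>1\<^sub>3, f\<^sub>2\<^sub>3\<close>, up to a constant, and it has to be shown that this number does not depend on \<open>y\<close>.

  Writing \<open>[\<dots>]\<close> for numbers of common zeros, the identity and inclusion-exclusion turn it into
  \<open>[T, f\<^sub>1\<^sub>3] + [T, f\<^sub>2\<^sub>3] - [T, f\<^sub>3]\<close>. Since \<open>a\<close> and \<open>b\<close> have degree 2 in \<open>K\<close>, the first two terms
  vanish modulo \<open>p\<close>: the polynomials depend only on the sum of the two variables at \<open>b\<close>,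
  respectively at \<open>a\<close>. In the last term the variables at \<open>a\<close> and \<open>b\<close> enter linearly and can be
  eliminated one vertex at a time; what remains counts the points where neither the tree sum of
  \<open>K - a - b\<close> nor a signed 2-forest sum not involving \<open>y\<close> vanishes. Loops, double edges and an
  edge between \<open>a\<close> and \<open>b\<close> are degenerate variants.
\<close>

section \<open>Connectivity and forests\<close>

definition conn :: "('e \<Rightarrow> 'v set) \<Rightarrow> 'e set \<Rightarrow> 'v \<Rightarrow> 'v \<Rightarrow> bool" where
  "conn g F u v \<longleftrightarrow> (u, v) \<in> {(x, y). \<exists>e\<in>F. g e = {x, y}}\<^sup>*"

definition forest :: "('e \<Rightarrow> 'v set) \<Rightarrow> 'e set \<Rightarrow> bool" where
  "forest g F \<longleftrightarrow> (\<forall>e\<in>F. \<forall>u z. g e = {u, z} \<longrightarrow> \<not> conn g (F - {e}) u z)"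

lemma conn_refl [simp]: "conn g F u u"
  by (simp add: conn_def)

lemma conn_trans [trans]: "conn g F u v \<Longrightarrow> conn g F v w \<Longrightarrow> conn g F u w"
  unfolding conn_def by (rule rtrancl_trans)

lemma conn_sym: "conn g F u v \<Longrightarrow> conn g F v u"
proof -
  have "sym {(x, y). \<exists>e\<in>F. g e = {x, y}}"
    by (auto simp: sym_def insert_commute)
  then show "conn g F u v \<Longrightarrow> conn g F v u"
    unfolding conn_def by (meson sym_rtrancl symD)
qed

lemma conn_commute: "conn g F u v \<longleftrightarrow> conn g F v u"
  using conn_sym by metis

lemma conn_cong: "conn g F u v \<Longrightarrow> conn g F u z \<longleftrightarrow> conn g F v z"
  using conn_sym conn_trans by metis

lemma conn_edge: "e \<in> F \<Longrightarrow> g e = {u, v} \<Longrightarrow> conn g F u v"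
  unfolding conn_def by (rule r_into_rtrancl) auto

lemma conn_mono: "conn g F u v \<Longrightarrow> F \<subseteq> F' \<Longrightarrow> conn g F' u v"
  unfolding conn_def by (erule rtrancl_mono[THEN subsetD, rotated]) auto

lemma conn_induct [consumes 1, case_names refl step]:
  assumes "conn g F u v"
    and "P u"
    and "\<And>x y e. conn g F u x \<Longrightarrow> P x \<Longrightarrow> e \<in> F \<Longrightarrow> g e = {x, y} \<Longrightarrow> P y"
  shows "P v"
  using assms(1) unfolding conn_def
  by (induction rule: rtrancl_induct) (auto intro: assms(2,3) simp: conn_def)

lemma conn_insert:
  assumes "g e = {u, z}"
  shows "conn g (insert e F) s t \<longleftrightarrow>
    conn g F s t \<or> conn g F s u \<and> conn g F z t \<or> conn g F s z \<and> conn g F u t"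
proof
  assume "conn g (insert e F) s t"
  then show "conn g F s t \<or> conn g F s u \<and> conn g F z t \<or> conn g F s z \<and> conn g F u t"
  proof (induction rule: conn_induct)
    case refl
    then show ?case by simp
  next
    case (step x y e')
    show ?case
    proof (cases "e' \<in> F")
      case True
      then have "conn g F x y" using step conn_edge by metis
      then show ?thesis using step.IH conn_trans by metis
    next
      case False
      then have "x = u \<and> y = z \<or> x = z \<and> y = u"
        using step.hyps assms by (auto simp: doubleton_eq_iff)
      then show ?thesis using step.IH conn_refl conn_trans conn_sym by metis
    qed
  qed
next
  have new: "conn g (insert e F) u z" using assms by (auto intro: conn_edge)
  have old: "conn g F x y \<Longrightarrow> conn g (insert e F) x y" for x y
    by (erule conn_mono) auto
  assume "conn g F s t \<or> conn g F s u \<and> conn g F z t \<or> conn g F s z \<and> conn g F u t"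
  then show "conn g (insert e F) s t"
    using old new conn_trans conn_sym by metis
qed

lemma conn_isolated:
  assumes "\<And>e. e \<in> F \<Longrightarrow> u \<notin> g e"
  shows "conn g F u v \<longleftrightarrow> u = v" and "conn g F v u \<longleftrightarrow> u = v"
proof -
  show "conn g F u v \<longleftrightarrow> u = v"
  proof
    assume "conn g F u v"
    then show "u = v"
    proof (induction rule: conn_induct)
      case (step x y e)
      then have "u \<in> g e" by blast
      then show ?case using assms step.hyps by blast
    qed (rule refl)
  qed auto
  then show "conn g F v u \<longleftrightarrow> u = v" by (simp add: conn_commute)
qed

lemma forest_mono: "forest g F \<Longrightarrow> F' \<subseteq> F \<Longrightarrow> forest g F'"
  unfolding forest_def by (meson conn_mono Diff_mono subset_refl subsetD)

lemma forest_insert: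
  assumes "g e = {u, z}" "e \<notin> F"
  shows "forest g (insert e F) \<longleftrightarrow> forest g F \<and> \<not> conn g F u z"
proof (intro iffI conjI)
  assume "forest g (insert e F)"
  then show "forest g F" by (rule forest_mono) auto
  show "\<not> conn g F u z" using \<open>forest g (insert e F)\<close> assms unfolding forest_def by auto
next
  assume F: "forest g F \<and> \<not> conn g F u z"
  show "forest g (insert e F)"
    unfolding forest_def
  proof (intro ballI allI impI notI)
    fix e' s t
    assume e': "e' \<in> insert e F" "g e' = {s, t}" and st: "conn g (insert e F - {e'}) s t"
    show False
    proof (cases "e' = e")
      case True
      then have "conn g F s t" "{s, t} = {u, z}" using st assms e' by auto
      then show False using F conn_sym by (metis doubleton_eq_iff)
    next
      case False
      then have "insert e F - {e'} = insert e (F - {e'})" "e' \<in> F" using e' by auto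
      then have "conn g (F - {e'}) s u \<and> conn g (F - {e'}) z t
          \<or> conn g (F - {e'}) s z \<and> conn g (F - {e'}) u t"
        using st F e'(2) conn_insert[of g e u z "F - {e'}" s t] assms(1)
        unfolding forest_def by auto
      moreover have "conn g F s t" using \<open>e' \<in> F\<close> e'(2) by (rule conn_edge)
      moreover have "conn g (F - {e'}) x y \<Longrightarrow> conn g F x y" for x y
        by (erule conn_mono) auto
      ultimately have "conn g F u z" using conn_trans conn_sym by metis
      then show False using F by simp
    qed
  qed
qed

lemma forest_no_loop: "forest g F \<Longrightarrow> e \<in> F \<Longrightarrow> g e \<noteq> {u}"
  unfolding forest_def by (metis conn_refl insert_absorb2)

section \<open>Rooted forests\<close>

text \<open>The roots form a multiset: if a root is repeated, then there are no such forests.\<close>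

definition rooted_forest :: "('v, 'e) multigraph \<Rightarrow> 'v multiset \<Rightarrow> 'e set \<Rightarrow> bool" where
  "rooted_forest G R F \<longleftrightarrow>
     forest (ends G) F \<and> (\<forall>z\<in>verts G. size {#r \<in># R. conn (ends G) F r z#} = 1)"

lemma rooted_forest_cong_root:
  "conn (ends G) F r s \<Longrightarrow> rooted_forest G (add_mset r R) F \<longleftrightarrow> rooted_forest G (add_mset s R) F"
  by (simp add: rooted_forest_def conn_cong[of "ends G" F r s])

lemma rooted_forest_separated:
  assumes "rooted_forest G (add_mset r R) F" "z \<in> verts G" "conn (ends G) F r z" "s \<in># R"
  shows "\<not> conn (ends G) F s z"
  using assms by (auto simp: rooted_forest_def)

lemma rooted_forest_unique_root:
  assumes G: "rooted_forest G R F" "z \<in> verts G"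
    and r: "r \<in># R" "conn (ends G) F r z" and s: "s \<in># R" "conn (ends G) F s z"
  shows "s = r"
proof (rule ccontr)
  assume "s \<noteq> r"
  moreover obtain R' where "R = add_mset r R'" using r(1) by (metis insert_DiffM)
  ultimately show False using rooted_forest_separated[of G r R' F z s] G r(2) s by simp
qed

lemma rooted_forest_root_exists:
  assumes "rooted_forest G R F" "z \<in> verts G"
  obtains r R' where "R = add_mset r R'" "conn (ends G) F r z"
proof -
  have "size {#r \<in># R. conn (ends G) F r z#} = 1" using assms by (simp add: rooted_forest_def)
  then have "{#r \<in># R. conn (ends G) F r z#} \<noteq> {#}" by (metis size_empty zero_neq_one)
  then obtain r where "r \<in># R" "conn (ends G) F r z" by auto
  then show ?thesis using that by (metis insert_DiffM)
qed

lemma rooted_forest_insert_edge: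
  assumes e: "ends G e = {r, u}" "e \<notin> F" and V: "r \<in> verts G" "u \<in> verts G"
  shows "rooted_forest G (add_mset r R) (insert e F) \<longleftrightarrow>
    rooted_forest G (add_mset r (add_mset u R)) F"
proof -
  let ?c = "conn (ends G) F" and ?c' = "conn (ends G) (insert e F)"
  let ?sep = "\<not> ?c r u \<and> (\<forall>s\<in>#R. \<not> ?c s r \<and> \<not> ?c s u)"
  note conn' = conn_insert[of "ends G" e, OF e(1)] and forest' = forest_insert[of "ends G" e, OF e]
  have "?sep" if "rooted_forest G (add_mset r R) (insert e F)"
    using rooted_forest_separated[OF that V(1)] that conn' forest'
    by (auto simp: rooted_forest_def)
  moreover have "?sep" if F: "rooted_forest G (add_mset r (add_mset u R)) F"
  proof -
    have "\<not> ?c s r" if "s \<in># add_mset u R" for s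
      using rooted_forest_separated[OF F V(1) conn_refl that] .
    moreover have "\<not> ?c s u" if "s \<in># add_mset r R" for s
      using rooted_forest_separated[of G u "add_mset r R" F, OF _ V(2) conn_refl that] F
      by (simp add: add_mset_commute)
    ultimately show ?thesis by simp
  qed
  moreover have "rooted_forest G (add_mset r R) (insert e F) \<longleftrightarrow>
      rooted_forest G (add_mset r (add_mset u R)) F" if sep: ?sep
  proof -
    have "{#s \<in># R. ?c' s z#} = {#s \<in># R. ?c s z#}" for z
      using sep by (intro filter_mset_cong refl) (auto simp: conn')
    moreover have "\<not> (?c r z \<and> ?c u z)" "?c' r z \<longleftrightarrow> ?c r z \<or> ?c u z" for z
      using sep conn' conn_commute conn_trans conn_refl by metis+
    ultimately have "size {#s \<in># add_mset r R. ?c' s z#} =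
        size {#s \<in># add_mset r (add_mset u R). ?c s z#}" for z
      by auto
    then show ?thesis unfolding rooted_forest_def forest' using sep by simp
  qed
  ultimately show ?thesis by blast
qed

lemma rooted_forest_star:
  assumes "finite S" "S \<inter> F = {}" "w \<in> verts G"
    and "\<And>e. e \<in> S \<Longrightarrow> ends G e = {w, f e} \<and> f e \<in> verts G"
  shows "rooted_forest G (add_mset w R) (S \<union> F) \<longleftrightarrow>
    rooted_forest G (add_mset w (image_mset f (mset_set S) + R)) F"
  using assms
proof (induction S arbitrary: R rule: finite_induct)
  case (insert e S)
  have "rooted_forest G (add_mset w R) (insert e (S \<union> F)) \<longleftrightarrow>
      rooted_forest G (add_mset w (add_mset (f e) R)) (S \<union> F)"
    using insert by (intro rooted_forest_insert_edge) auto
  then show ?case using insert by simp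
qed simp

lemma rooted_forest_isolated:
  assumes "\<And>e. e \<in> F \<Longrightarrow> w \<notin> ends G e" "w \<in> verts G" "w \<notin># R"
  shows "\<not> rooted_forest G R F"
    and "rooted_forest G (add_mset w R) F \<longleftrightarrow> rooted_forest (delete_vertex G w) R F"
proof -
  have w: "conn (ends G) F w z \<longleftrightarrow> w = z" "conn (ends G) F z w \<longleftrightarrow> w = z" for z
    using conn_isolated[of F w "ends G"] assms(1) by auto
  have none: "size {#r \<in># R. conn (ends G) F r w#} = 0"
    using assms(3) by (auto simp: w)
  then show "\<not> rooted_forest G R F"
    using assms(2) unfolding rooted_forest_def by (metis zero_neq_one)
  have "verts G = insert w (verts (delete_vertex G w))" "w \<notin> verts (delete_vertex G w)"
    using assms(2) by (auto simp: delete_vertex_def)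
  then show "rooted_forest G (add_mset w R) F \<longleftrightarrow> rooted_forest (delete_vertex G w) R F"
    using none by (auto simp: rooted_forest_def w delete_vertex_def)
qed

lemma rooted_forest_pendant:
  assumes F: "\<And>d. d \<in> F \<Longrightarrow> w \<notin> ends G d" and e: "ends G e = {w, u}"
    and V: "w \<in> verts G" "u \<in> verts G" "u \<noteq> w" "w \<notin># R"
  shows "rooted_forest G R (insert e F) \<longleftrightarrow> rooted_forest (delete_vertex G w) R F"
proof -
  have w: "conn (ends G) F w z \<longleftrightarrow> w = z" "conn (ends G) F z w \<longleftrightarrow> w = z" for z
    using conn_isolated[of F w "ends G"] F by auto
  have "e \<notin> F" using F e by auto
  then have "forest (ends G) (insert e F) \<longleftrightarrow> forest (ends G) F"
    using forest_insert[of "ends G" e w u F] e V(3) w by auto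
  moreover have "{#r \<in># R. conn (ends G) (insert e F) r z#} =
      {#r \<in># R. conn (ends G) F r (if z = w then u else z)#}" for z
    using V by (intro filter_mset_cong refl) (auto simp: conn_insert[of "ends G" e w u] e w)
  ultimately show ?thesis
    using V by (auto simp: rooted_forest_def delete_vertex_def)
qed

section \<open>Spanning trees as rooted forests\<close>

lemma ends_subset_verts: "wf_graph G \<Longrightarrow> e \<in> edges G \<Longrightarrow> ends G e \<subseteq> verts G"
  unfolding wf_graph_def by fastforce

lemma walk_conn:
  assumes "walk G u s w" "set (map fst s) \<subseteq> F"
  shows "conn (ends G) F u w"
  using assms
proof (induction G u s w rule: walk.induct)
  case (2 G u e x s w)
  then have "conn (ends G) F u x" by (intro conn_edge[of e]) auto
  moreover have "conn (ends G) F x w" using 2 by auto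
  ultimately show ?case by (rule conn_trans)
qed simp

lemma walk_edges: "walk G u s w \<Longrightarrow> set (map fst s) \<subseteq> edges G"
  by (induction G u s w rule: walk.induct) auto

lemma walk_edge_ends:
  "walk G u s w \<Longrightarrow> e \<in> set (map fst s) \<Longrightarrow> ends G e \<subseteq> set (u # map snd s)"
  by (induction G u s w rule: walk.induct) auto

lemma walk_suffix: "walk G u (s @ (e, x) # t) w \<Longrightarrow> walk G x t w"
  by (induction G u s w rule: walk.induct) auto

lemma conn_imp_simple_walk:
  assumes wf: "wf_graph G" and "conn (ends G) F u w" "F \<subseteq> edges G" "w \<in> verts G"
  shows "\<exists>s. walk G u s w \<and> set (map fst s) \<subseteq> F \<and> distinct (map fst s) \<and> distinct (u # map snd s)"
proof -
  have "conn (ends G) F w u" using assms(2) by (rule conn_sym)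
  then show ?thesis
  proof (induction rule: conn_induct)
    case refl
    then show ?case using assms(4) by (intro exI[of _ "[]"]) auto
  next
    case (step x y e)
    then obtain s where s: "walk G x s w" "set (map fst s) \<subseteq> F" "distinct (map fst s)"
      "distinct (x # map snd s)" by blast
    consider "y = x" | "y \<in> snd ` set s" | "y \<notin> set (x # map snd s)" by auto
    then show ?case
    proof cases
      case 1
      then show ?thesis using s by blast
    next
      case 2
      then obtain e' s1 s2 where "s = s1 @ (e', y) # s2" by (auto dest: split_list)
      then show ?thesis using s walk_suffix[of G x s1 e' y s2 w] by (intro exI[of _ s2]) auto
    next
      case 3
      have "y \<in> verts G" using ends_subset_verts[OF wf, of e] step.hyps assms(3) by auto
      then have "walk G y ((e, x) # s) w"
        using s(1) step.hyps assms(3) by (auto simp: insert_commute)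
      moreover have "e \<notin> set (map fst s)"
        using walk_edge_ends[OF s(1), of e] step.hyps(3) 3 by auto
      ultimately show ?thesis using s step.hyps 3 by (intro exI[of _ "(e, x) # s"]) auto
    qed
  qed
qed

lemma connected_graph_iff_conn:
  assumes "wf_graph G" "r \<in> verts G"
  shows "connected_graph G \<longleftrightarrow> (\<forall>z\<in>verts G. conn (ends G) (edges G) r z)"
proof
  assume "connected_graph G"
  then show "\<forall>z\<in>verts G. conn (ends G) (edges G) r z"
    unfolding connected_graph_def using assms(2) walk_conn walk_edges by metis
next
  assume r: "\<forall>z\<in>verts G. conn (ends G) (edges G) r z"
  have "\<exists>s. walk G u s w" if "u \<in> verts G" "w \<in> verts G" for u w
  proof -
    have "conn (ends G) (edges G) u w" using r that conn_sym conn_trans by metis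
    then show ?thesis using conn_imp_simple_walk[OF assms(1)] that by blast
  qed
  then show "connected_graph G" unfolding connected_graph_def using assms(2) by blast
qed

lemma acyclic_iff_forest:
  assumes wf: "wf_graph G"
  shows "(\<nexists>u s. is_cycle G u s) \<longleftrightarrow> forest (ends G) (edges G)"
proof
  assume acyclic: "\<nexists>u s. is_cycle G u s"
  show "forest (ends G) (edges G)"
    unfolding forest_def
  proof (intro ballI allI impI notI)
    fix e u z
    assume e: "e \<in> edges G" "ends G e = {u, z}" and uz: "conn (ends G) (edges G - {e}) u z"
    have V: "u \<in> verts G" "z \<in> verts G" using ends_subset_verts[OF wf e(1)] e(2) by auto
    obtain s where "walk G u s z" "set (map fst s) \<subseteq> edges G - {e}" "distinct (map fst s)"
      "distinct (u # map snd s)"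
      using conn_imp_simple_walk[OF wf uz _ V(2)] by auto
    then have "is_cycle G z ((e, u) # s)"
      using e V by (auto simp: is_cycle_def insert_commute)
    then show False using acyclic by blast
  qed
next
  assume forest: "forest (ends G) (edges G)"
  show "\<nexists>u s. is_cycle G u s"
  proof (intro notI, elim exE)
    fix u s
    assume cycle: "is_cycle G u s"
    then obtain e x t where s: "s = (e, x) # t" unfolding is_cycle_def by (cases s) auto
    then have t: "e \<in> edges G" "ends G e = {u, x}" "walk G x t u" "e \<notin> set (map fst t)"
      using cycle unfolding is_cycle_def by auto
    then have "conn (ends G) (edges G - {e}) x u"
      using walk_edges[OF t(3)] by (intro walk_conn[OF t(3)]) auto
    then have "conn (ends G) (edges G - {e}) u x" by (rule conn_sym)
    then show False using forest t unfolding forest_def by blast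
  qed
qed

lemma is_tree_iff_rooted_forest:
  assumes "wf_graph G" "r \<in> verts G"
  shows "is_tree G \<longleftrightarrow> rooted_forest G {#r#} (edges G)"
  unfolding is_tree_def rooted_forest_def connected_graph_iff_conn[OF assms]
    acyclic_iff_forest[OF assms(1)]
  by auto

section \<open>Spanning forest polynomials\<close>

definition edge_sum :: "'e set \<Rightarrow> ('e set \<Rightarrow> 'a::comm_ring_1) \<Rightarrow> ('e \<Rightarrow> 'a) \<Rightarrow> 'a" where
  "edge_sum E w \<alpha> = (\<Sum>F\<in>Pow E. w F * prod \<alpha> (E - F))"

definition forest_sum :: "('v, 'e) multigraph \<Rightarrow> 'v multiset \<Rightarrow> ('e \<Rightarrow> 'a::comm_ring_1) \<Rightarrow> 'a" where
  "forest_sum G R = edge_sum (edges G) (\<lambda>F. of_bool (rooted_forest G R F))"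

definition split_sum ::
    "('v, 'e) multigraph \<Rightarrow> 'v \<Rightarrow> 'v multiset \<Rightarrow> 'v \<Rightarrow> ('e \<Rightarrow> 'a::comm_ring_1) \<Rightarrow> 'a" where
  "split_sum G r R u =
     edge_sum (edges G) (\<lambda>F. of_bool (rooted_forest G (add_mset r R) F \<and> conn (ends G) F r u))"

lemma edge_sum_cong:
  "(\<And>F. F \<subseteq> E \<Longrightarrow> w F = w' F) \<Longrightarrow> edge_sum E w \<alpha> = edge_sum E w' \<alpha>"
  by (simp add: edge_sum_def)

lemma edge_sum_eq_0: "(\<And>F. F \<subseteq> E \<Longrightarrow> w F = 0) \<Longrightarrow> edge_sum E w \<alpha> = 0"
  by (simp add: edge_sum_def)

lemma edge_sum_diff: "edge_sum E (\<lambda>F. w F - w' F) \<alpha> = edge_sum E w \<alpha> - edge_sum E w' \<alpha>"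
  by (simp add: edge_sum_def sum_subtractf left_diff_distrib)

lemma edge_sum_add: "edge_sum E (\<lambda>F. w F + w' F) \<alpha> = edge_sum E w \<alpha> + edge_sum E w' \<alpha>"
  by (simp add: edge_sum_def sum.distrib distrib_right)

lemma edge_sum_mult_right: "edge_sum E (\<lambda>F. w F * c) \<alpha> = edge_sum E w \<alpha> * c"
  by (simp add: edge_sum_def sum_distrib_left sum_distrib_right mult_ac)

lemma edge_sum_upd [simp]: "e \<notin> E \<Longrightarrow> edge_sum E w (\<alpha>(e := x)) = edge_sum E w \<alpha>"
  unfolding edge_sum_def by (intro sum.cong refl arg_cong2[of _ _ _ _ "(*)"] prod.cong) auto

lemma edge_sum_Un:
  assumes "finite A" "finite E" "A \<inter> E = {}"
  shows "edge_sum (A \<union> E) w \<alpha> = (\<Sum>S\<in>Pow A. prod \<alpha> (A - S) * edge_sum E (\<lambda>F. w (S \<union> F)) \<alpha>)"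
proof -
  have "edge_sum (A \<union> E) w \<alpha> = (\<Sum>(S, F)\<in>Pow A \<times> Pow E. w (S \<union> F) * prod \<alpha> (A \<union> E - (S \<union> F)))"
    unfolding edge_sum_def
    by (rule sum.reindex_bij_witness[where i = "\<lambda>(S, F). S \<union> F" and j = "\<lambda>F. (F \<inter> A, F \<inter> E)"])
      (use assms(3) in \<open>auto simp: Int_Un_distrib[symmetric] Int_absorb2\<close>)
  also have "\<dots> = (\<Sum>(S, F)\<in>Pow A \<times> Pow E. prod \<alpha> (A - S) * (w (S \<union> F) * prod \<alpha> (E - F)))"
  proof (intro sum.cong refl, clarsimp)
    fix S F assume "S \<subseteq> A" "F \<subseteq> E"
    then have "A \<union> E - (S \<union> F) = (A - S) \<union> (E - F)" "(A - S) \<inter> (E - F) = {}" using assms(3) by auto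
    then show "w (S \<union> F) * prod \<alpha> (A \<union> E - (S \<union> F)) = prod \<alpha> (A - S) * (w (S \<union> F) * prod \<alpha> (E - F))"
      using assms(1,2) by (simp add: prod.union_disjoint mult_ac)
  qed
  finally show ?thesis by (simp add: sum.cartesian_product[symmetric] edge_sum_def sum_distrib_left)
qed

lemma edge_sum_insert:
  assumes "finite E" "e \<notin> E"
  shows "edge_sum (insert e E) w \<alpha> = \<alpha> e * edge_sum E w \<alpha> + edge_sum E (\<lambda>F. w (insert e F)) \<alpha>"
proof -
  have "Pow {e} = {{}, {e}}" by auto
  then show ?thesis using edge_sum_Un[of "{e}" E w \<alpha>] assms by simp
qed

lemma forest_sum_upd [simp]: "e \<notin> edges G \<Longrightarrow> forest_sum G R (\<alpha>(e := x)) = forest_sum G R \<alpha>"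
  by (simp add: forest_sum_def)

lemma split_sum_upd [simp]: "e \<notin> edges G \<Longrightarrow> split_sum G r R u (\<alpha>(e := x)) = split_sum G r R u \<alpha>"
  by (simp add: split_sum_def)

lemma forest_sum_eq_0: "(\<And>F. F \<subseteq> edges G \<Longrightarrow> \<not> rooted_forest G R F) \<Longrightarrow> forest_sum G R \<alpha> = 0"
  by (simp add: forest_sum_def edge_sum_eq_0)

lemma kirchhoff_eq_forest_sum:
  assumes wf: "wf_graph G" and r: "r \<in> verts G"
  shows "kirchhoff G \<alpha> = forest_sum G {#r#} \<alpha>"
proof -
  have "is_tree (G\<lparr>edges := T\<rparr>) \<longleftrightarrow> rooted_forest G {#r#} T" if "T \<subseteq> edges G" for T
  proof -
    have "wf_graph (G\<lparr>edges := T\<rparr>)"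
      using wf that finite_subset[of T "edges G"] unfolding wf_graph_def by auto
    from is_tree_iff_rooted_forest[OF this, of r] show ?thesis
      using r by (simp add: rooted_forest_def)
  qed
  then have trees: "spanning_trees G = {T \<in> Pow (edges G). rooted_forest G {#r#} T}"
    by (auto simp: spanning_trees_def)
  have "kirchhoff G \<alpha> =
      (\<Sum>T\<in>Pow (edges G). if rooted_forest G {#r#} T then prod \<alpha> (edges G - T) else 0)"
    unfolding kirchhoff_def trees using wf by (intro sum.inter_filter) (simp add: wf_graph_def)
  also have "\<dots> = forest_sum G {#r#} \<alpha>"
    unfolding forest_sum_def edge_sum_def by (intro sum.cong) auto
  finally show ?thesis .
qed

lemma forest_sum_repeated_root_eq_0:
  assumes "r \<in> verts G"
  shows "forest_sum G (add_mset r (add_mset r R)) \<alpha> = 0"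
  using rooted_forest_separated[OF _ assms conn_refl, of "add_mset r R"]
  by (intro forest_sum_eq_0) (metis conn_refl union_single_eq_member)

lemma forest_sum_no_root_eq_0:
  assumes "verts G \<noteq> {}"
  shows "forest_sum G {#} \<alpha> = 0"
  using assms by (intro forest_sum_eq_0) (auto simp: rooted_forest_def)

lemma split_sum_self: "split_sum G r R r \<alpha> = forest_sum G (add_mset r R) \<alpha>"
  by (simp add: split_sum_def forest_sum_def)

lemma split_sum_root_eq_0:
  assumes "r \<in> verts G" "y \<in># R"
  shows "split_sum G r R y \<alpha> = 0"
proof -
  have "\<not> (rooted_forest G (add_mset r R) F \<and> conn (ends G) F r y)" for F
    using rooted_forest_separated[OF _ assms(1) conn_refl assms(2)] conn_commute by metis
  then show ?thesis unfolding split_sum_def by (intro edge_sum_eq_0) simp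
qed

lemma split_sum_swap: "split_sum G r R u \<alpha> = split_sum G u R r \<alpha>"
  unfolding split_sum_def
  by (intro edge_sum_cong arg_cong[of _ _ of_bool]) (metis rooted_forest_cong_root conn_commute)

lemma forest_sum_eq_split_sum_add:
  fixes \<alpha> :: "'e \<Rightarrow> 'a::comm_ring_1"
  assumes "u \<in> verts G"
  shows "forest_sum G {#r, s#} \<alpha> = split_sum G r {#s#} u \<alpha> + split_sum G s {#r#} u \<alpha>"
proof -
  have "of_bool (rooted_forest G {#r, s#} F) =
      (of_bool (rooted_forest G {#r, s#} F \<and> conn (ends G) F r u) +
       of_bool (rooted_forest G {#s, r#} F \<and> conn (ends G) F s u) :: 'a)" for F
  proof (cases "rooted_forest G {#r, s#} F")
    case True
    then have "conn (ends G) F r u \<noteq> conn (ends G) F s u"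
      using assms by (auto simp: rooted_forest_def split: if_splits)
    then show ?thesis using True by (auto simp: add_mset_commute)
  qed (simp add: add_mset_commute)
  then show ?thesis unfolding forest_sum_def split_sum_def edge_sum_add[symmetric] by simp
qed

lemma forest_sum_two_roots:
  assumes "a \<in> verts G" "b \<in> verts G" "y \<in> verts G"
  shows "forest_sum G {#a, b#} \<alpha> =
    forest_sum G {#a, y#} \<alpha> + forest_sum G {#b, y#} \<alpha> - 2 * split_sum G a {#y#} b \<alpha>"
  using forest_sum_eq_split_sum_add[OF assms(1), of b y \<alpha>]
    forest_sum_eq_split_sum_add[OF assms(2), of a y \<alpha>]
    forest_sum_eq_split_sum_add[OF assms(3), of a b \<alpha>]
    split_sum_swap[of G y "{#a#}" b \<alpha>] split_sum_swap[of G y "{#b#}" a \<alpha>]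
    split_sum_swap[of G b "{#y#}" a \<alpha>]
  by (simp add: algebra_simps)

lemma split_sum_exchange:
  fixes \<alpha> :: "'e \<Rightarrow> 'a::comm_ring_1"
  assumes "c \<in> verts G" "d \<in> verts G" "y \<in> verts G" "u \<in> verts G"
  shows "split_sum G c {#y#} u \<alpha> - split_sum G d {#y#} u \<alpha> =
    split_sum G c {#d#} u \<alpha> - split_sum G c {#d#} y \<alpha>"
  unfolding split_sum_def edge_sum_diff[symmetric]
proof (intro edge_sum_cong)
  fix F
  let ?c = "conn (ends G) F" and ?r = "\<lambda>r s. rooted_forest G {#r, s#} F"
  have swap: "?r r s \<longleftrightarrow> ?r s r" for r s by (simp add: add_mset_commute)
  have root: "?c r r' \<Longrightarrow> ?r r s \<longleftrightarrow> ?r r' s" for r r' s by (rule rooted_forest_cong_root)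
  have cover: "?r r s \<Longrightarrow> z \<in> verts G \<Longrightarrow> ?c r z \<longleftrightarrow> \<not> ?c s z" for r s z
    by (auto simp: rooted_forest_def split: if_splits)
  consider "?c c d" | "?c d y" "\<not> ?c c d" | "?c c y" "\<not> ?c c d"
    | "\<not> ?c c d" "\<not> ?c d y" "\<not> ?c c y" by blast
  then show "of_bool (?r c y \<and> ?c c u) - of_bool (?r d y \<and> ?c d u) =
      (of_bool (?r c d \<and> ?c c u) - of_bool (?r c d \<and> ?c c y) :: 'a)"
  proof cases
    case 1
    then show ?thesis
      using root[OF 1, of y] cover[of c d c] assms(1) conn_cong[OF 1]
        conn_commute[of "ends G" F c d] by auto
  next
    case 2
    then have "\<not> ?r d y" "?r c y \<longleftrightarrow> ?r c d"
      using cover[of d y y] root[OF 2(1), of c] swap[of c y] swap[of c d] assms(3) by auto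
    moreover have "\<not> ?c c y"
      using 2 conn_trans[of "ends G" F c y d] conn_commute[of "ends G" F d y] by blast
    ultimately show ?thesis by simp
  next
    case 3
    then have "\<not> ?r c y" "?r d y \<longleftrightarrow> ?r c d"
      using cover[of c y y] root[OF 3(1), of d] swap[of d c] swap[of d y] assms(3) by auto
    then show ?thesis using cover[of c d u] assms(4) 3(1) by auto
  next
    case 4
    then have "\<not> ?r c y" "\<not> ?r d y" "\<not> ?r c d"
      using cover[of c y d] cover[of d y c] cover[of c d y] assms conn_commute[of "ends G" F]
      by metis+
    then show ?thesis by simp
  qed
qed

section \<open>The three-root identity\<close>

lemma rooted_forest_split_off:
  assumes e: "ends G e = {s, t}" "e \<notin> F" and V: "b \<in> verts G" "s \<in> verts G" "t \<in> verts G"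
    and b: "conn (ends G) F b s" "\<not> conn (ends G) F b t"
  shows "rooted_forest G (add_mset b R) F \<longleftrightarrow>
    rooted_forest G R (insert e F) \<and> (\<exists>r\<in>#R. conn (ends G) F r t)"
proof -
  have join: "rooted_forest G (add_mset b R) F \<longleftrightarrow> rooted_forest G R (insert e F)"
    if r: "r \<in># R" "conn (ends G) F r t" for r
  proof -
    obtain R' where R: "R = add_mset r R'" using r(1) by (metis insert_DiffM)
    have "rooted_forest G (add_mset b R) F \<longleftrightarrow> rooted_forest G (add_mset r (add_mset s R')) F"
      unfolding R by (simp add: rooted_forest_cong_root[OF b(1)] add_mset_commute)
    also have "\<dots> \<longleftrightarrow> rooted_forest G (add_mset t (add_mset s R')) F"
      by (rule rooted_forest_cong_root[OF r(2)])
    also have "\<dots> \<longleftrightarrow> rooted_forest G (add_mset t R') (insert e F)"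
      using e V by (intro rooted_forest_insert_edge[symmetric]) (auto simp: insert_commute)
    also have "\<dots> \<longleftrightarrow> rooted_forest G R (insert e F)"
      unfolding R by (rule rooted_forest_cong_root) (metis conn_mono conn_sym r(2) subset_insertI)
    finally show ?thesis .
  qed
  have "\<exists>r\<in>#R. conn (ends G) F r t" if F: "rooted_forest G (add_mset b R) F"
  proof -
    obtain r R' where r: "add_mset b R = add_mset r R'" "conn (ends G) F r t"
      using rooted_forest_root_exists[OF F V(3)] .
    then have "r \<in># R" using b(2) by (metis insert_noteq_member union_single_eq_member)
    then show ?thesis using r(2) by blast
  qed
  then show ?thesis using join by blast
qed

lemma rooted_forest_cut:
  assumes e: "ends G e = {s, t}" "e \<notin> F" and V: "b \<in> verts G" "s \<in> verts G" "t \<in> verts G"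
    and root: "rooted_forest G R (insert e F) \<Longrightarrow> r \<in># R \<and> conn (ends G) (insert e F) r b"
  shows "of_bool (rooted_forest G (add_mset b R) F) *
      (of_bool (conn (ends G) F b s) - of_bool (conn (ends G) F b t)) =
    (of_bool (rooted_forest G R (insert e F)) *
      (of_bool (conn (ends G) F b s) - of_bool (conn (ends G) F r s)) :: 'a::comm_ring_1)"
proof (cases "rooted_forest G R (insert e F)")
  case False
  have "ends G e = {t, s}" using e(1) by (simp add: insert_commute)
  then have "conn (ends G) F b s \<longleftrightarrow> conn (ends G) F b t" if "rooted_forest G (add_mset b R) F"
    using that False rooted_forest_split_off[OF e V, of R]
      rooted_forest_split_off[OF _ e(2) V(1,3,2), of R] by metis
  then show ?thesis using False by auto
next
  case True
  let ?c = "conn (ends G) F"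
  have sep: "\<not> ?c s t"
    using True forest_insert[of "ends G" e s t F, OF e] by (simp add: rooted_forest_def)
  note insert = conn_insert[of "ends G" e s t F, OF e(1)]
  have r: "r \<in># R" "conn (ends G) (insert e F) r b" using root True by auto
  have root_eq: "x = r" if "x \<in># R" "?c b s \<and> ?c x t \<or> ?c b t \<and> ?c x s" for x
    using that insert[of x b] conn_sym[of "ends G" F]
    by (intro rooted_forest_unique_root[OF True V(1) r]) blast+
  consider "?c b s" "?c b t" | "\<not> ?c b s" "\<not> ?c b t" | "?c b s" "\<not> ?c b t" | "\<not> ?c b s" "?c b t"
    by blast
  then show ?thesis
  proof cases
    case 1
    then show ?thesis using sep conn_sym conn_trans by metis
  next
    case 2
    then have "?c r b" using r(2) insert[of r b] conn_sym[of "ends G" F] by blast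
    then show ?thesis using 2 conn_cong[of "ends G" F r b s] by simp
  next
    case 3
    have "?c r s \<or> ?c r t" using r(2) 3 insert conn_trans by metis
    then have "(\<exists>x\<in>#R. ?c x t) \<longleftrightarrow> \<not> ?c r s"
      using root_eq 3(1) r(1) sep conn_sym conn_trans by metis
    then show ?thesis using 3 True rooted_forest_split_off[OF e V 3] by simp
  next
    case 4
    have "(\<exists>x\<in>#R. ?c x s) \<longleftrightarrow> ?c r s" using root_eq r(1) 4(2) by metis
    then show ?thesis
      using 4 True rooted_forest_split_off[of G e t s F b R] e V by (simp add: insert_commute)
  qed
qed

lemma sum_edge_sum_remove_edge:
  assumes "finite E"
  shows "(\<Sum>e\<in>E. edge_sum (E - {e}) (\<lambda>F. w F e) \<alpha>) = edge_sum E (\<lambda>H. \<Sum>e\<in>H. w (H - {e}) e) \<alpha>"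
proof -
  have "(\<Sum>e\<in>E. edge_sum (E - {e}) (\<lambda>F. w F e) \<alpha>) =
      (\<Sum>(e, F)\<in>(SIGMA e:E. Pow (E - {e})). w F e * prod \<alpha> (E - {e} - F))"
    unfolding edge_sum_def using assms by (intro sum.Sigma) auto
  also have "\<dots> = (\<Sum>(H, e)\<in>(SIGMA H:Pow E. H). w (H - {e}) e * prod \<alpha> (E - H))"
  proof (rule sum.reindex_bij_witness[where j = "\<lambda>(e, F). (insert e F, e)"
        and i = "\<lambda>(H, e). (e, H - {e})"], goal_cases)
    case (5 x)
    obtain e F where x: "x = (e, F)" "F \<subseteq> E - {e}" using 5 by auto
    then have "insert e F - {e} = F" "E - insert e F = E - {e} - F" by auto
    then show ?case by (simp add: x(1))
  qed auto
  also have "\<dots> = (\<Sum>H\<in>Pow E. \<Sum>e\<in>H. w (H - {e}) e * prod \<alpha> (E - H))"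
    using assms by (intro sum.Sigma[symmetric]) (auto intro: finite_subset)
  finally show ?thesis by (simp add: edge_sum_def sum_distrib_right)
qed

locale oriented_graph =
  fixes G :: "('v, 'e) multigraph" and src tgt :: "'e \<Rightarrow> 'v"
  assumes wf: "wf_graph G"
    and ends: "e \<in> edges G \<Longrightarrow> ends G e = {src e, tgt e}"
begin

lemma src_tgt_in_verts:
  assumes "e \<in> edges G"
  shows "src e \<in> verts G" "tgt e \<in> verts G"
  using ends_subset_verts[OF wf assms] ends[OF assms] by auto

text \<open>
  In a forest, the edges of the path from \<open>b\<close> to \<open>r\<close> are those that separate the two vertices, so
  that the sum telescopes along the path.
\<close>

lemma sum_path_differences:
  fixes W :: "'v \<Rightarrow> 'a::comm_ring_1"
  assumes H: "H \<subseteq> edges G" "forest (ends G) H" and path: "conn (ends G) H b r"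
  shows "(\<Sum>e\<in>H. (of_bool (conn (ends G) (H - {e}) b (src e)) -
      of_bool (conn (ends G) (H - {e}) r (src e))) * (W (src e) - W (tgt e))) = W b - W r"
  using path
proof (induction rule: conn_induct)
  case refl
  then show ?case by simp
next
  case (step x y d)
  let ?c = "\<lambda>e x. of_bool (conn (ends G) (H - {e}) x (src e)) :: 'a"
  let ?W = "\<lambda>e. W (src e) - W (tgt e)"
  have "(?c e x - ?c e y) * ?W e = (if e = d then W x - W y else 0)" if e: "e \<in> H" for e
  proof (cases "e = d")
    case True
    have "\<not> conn (ends G) (H - {d}) x y" using H(2) step.hyps unfolding forest_def by blast
    moreover have "{x, y} = {src d, tgt d}" using ends[of d] H(1) step.hyps by auto
    ultimately show ?thesis
      using True conn_commute[of "ends G" "H - {d}" x y] by (auto simp: doubleton_eq_iff)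
  next
    case False
    then have "conn (ends G) (H - {e}) x y"
      using step.hyps conn_edge[of d "H - {e}" "ends G" x y] by auto
    then show ?thesis using False conn_cong[of "ends G" "H - {e}" x y] by simp
  qed
  moreover have "finite H" using H(1) wf finite_subset by (auto simp: wf_graph_def)
  ultimately have "(\<Sum>e\<in>H. (?c e x - ?c e y) * ?W e) = W x - W y" using step.hyps(2) by simp
  moreover have "(\<Sum>e\<in>H. (?c e b - ?c e y) * ?W e) =
      (\<Sum>e\<in>H. (?c e b - ?c e x) * ?W e) + (\<Sum>e\<in>H. (?c e x - ?c e y) * ?W e)"
    unfolding sum.distrib[symmetric] by (intro sum.cong refl) (simp add: algebra_simps)
  ultimately show ?case using step.IH by simp
qed

text \<open>
  With \<open>\<alpha>\<close> as resistances, \<open>split_sum G b R\<close> is a multiple of the potential of the network that is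
  grounded at \<open>R\<close> and fed at \<open>b\<close>, and \<open>current b R \<alpha> e\<close> the same multiple of the current along \<open>e\<close>.
\<close>

definition current :: "'v \<Rightarrow> 'v multiset \<Rightarrow> ('e \<Rightarrow> 'a::comm_ring_1) \<Rightarrow> 'e \<Rightarrow> 'a" where
  "current b R \<alpha> e = edge_sum (edges G - {e}) (\<lambda>F. of_bool (rooted_forest G (add_mset b R) F) *
     (of_bool (conn (ends G) F b (src e)) - of_bool (conn (ends G) F b (tgt e)))) \<alpha>"

lemma split_sum_src_diff_tgt:
  fixes \<alpha> :: "'e \<Rightarrow> 'a::comm_ring_1"
  assumes e: "e \<in> edges G"
  shows "split_sum G b R (src e) \<alpha> - split_sum G b R (tgt e) \<alpha> = \<alpha> e * current b R \<alpha> e"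
proof -
  let ?w = "\<lambda>F. of_bool (rooted_forest G (add_mset b R) F) *
     (of_bool (conn (ends G) F b (src e)) - of_bool (conn (ends G) F b (tgt e))) :: 'a"
  have "?w (insert e F) = 0" for F
  proof -
    have "conn (ends G) (insert e F) (src e) (tgt e)" using ends[OF e] by (auto intro: conn_edge)
    then have "conn (ends G) (insert e F) b (src e) \<longleftrightarrow> conn (ends G) (insert e F) b (tgt e)"
      using conn_sym conn_trans by metis
    then show ?thesis by simp
  qed
  then have "edge_sum (insert e (edges G - {e})) ?w \<alpha> = \<alpha> e * current b R \<alpha> e"
    using wf by (subst edge_sum_insert) (auto simp: wf_graph_def current_def edge_sum_eq_0)
  then show ?thesis
    unfolding split_sum_def edge_sum_diff[symmetric] of_bool_conj right_diff_distrib[symmetric]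
    using e by (simp add: insert_absorb)
qed

lemma sum_current_differences:
  fixes W :: "'v \<Rightarrow> 'a::comm_ring_1"
  assumes b: "b \<in> verts G"
    and root: "\<And>H. H \<subseteq> edges G \<Longrightarrow> rooted_forest G R H \<Longrightarrow> \<rho> H \<in># R \<and> conn (ends G) H (\<rho> H) b"
  shows "(\<Sum>e\<in>edges G. current b R \<alpha> e * (W (src e) - W (tgt e))) =
    edge_sum (edges G) (\<lambda>H. of_bool (rooted_forest G R H) * (W b - W (\<rho> H))) \<alpha>"
proof -
  let ?c = "\<lambda>F x y. of_bool (conn (ends G) F x y) :: 'a"
  have "(\<Sum>e\<in>edges G. current b R \<alpha> e * (W (src e) - W (tgt e))) =
      edge_sum (edges G) (\<lambda>H. \<Sum>e\<in>H. of_bool (rooted_forest G (add_mset b R) (H - {e})) *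
        (?c (H - {e}) b (src e) - ?c (H - {e}) b (tgt e)) * (W (src e) - W (tgt e))) \<alpha>"
    unfolding current_def edge_sum_mult_right[symmetric]
    using wf by (intro sum_edge_sum_remove_edge) (simp add: wf_graph_def)
  also have "\<dots> = edge_sum (edges G) (\<lambda>H. of_bool (rooted_forest G R H) * (W b - W (\<rho> H))) \<alpha>"
  proof (intro edge_sum_cong)
    fix H assume H: "H \<subseteq> edges G"
    have "of_bool (rooted_forest G (add_mset b R) (H - {e})) *
        (?c (H - {e}) b (src e) - ?c (H - {e}) b (tgt e)) =
      of_bool (rooted_forest G R H) * (?c (H - {e}) b (src e) - ?c (H - {e}) (\<rho> H) (src e))"
      if e: "e \<in> H" for e
      using rooted_forest_cut[of G e "src e" "tgt e" "H - {e}" b R "\<rho> H"] src_tgt_in_verts[of e]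
        ends[of e] b root[OF H] e H by (auto simp: insert_absorb)
    then have "(\<Sum>e\<in>H. of_bool (rooted_forest G (add_mset b R) (H - {e})) *
        (?c (H - {e}) b (src e) - ?c (H - {e}) b (tgt e)) * (W (src e) - W (tgt e))) =
      of_bool (rooted_forest G R H) * (\<Sum>e\<in>H.
        (?c (H - {e}) b (src e) - ?c (H - {e}) (\<rho> H) (src e)) * (W (src e) - W (tgt e)))"
      by (simp add: sum_distrib_left mult.assoc)
    also have "\<dots> = of_bool (rooted_forest G R H) * (W b - W (\<rho> H))"
      using sum_path_differences[OF H, of b "\<rho> H" W] root[OF H] conn_commute[of "ends G" H]
      by (auto simp: rooted_forest_def)
    finally show "(\<Sum>e\<in>H. of_bool (rooted_forest G (add_mset b R) (H - {e})) *
        (?c (H - {e}) b (src e) - ?c (H - {e}) b (tgt e)) * (W (src e) - W (tgt e))) = \<dots>" .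
  qed
  finally show ?thesis .
qed

end

text \<open>
  Green's identity for the potentials with source \<open>b\<close> that are grounded at \<open>y\<close> and at \<open>a, y\<close>.
\<close>

lemma forest_sum_three_roots:
  fixes \<alpha> :: "'e \<Rightarrow> 'a::comm_ring_1"
  assumes wf: "wf_graph G" and V: "a \<in> verts G" "b \<in> verts G" "y \<in> verts G"
  shows "forest_sum G {#y#} \<alpha> * forest_sum G {#a, b, y#} \<alpha> =
    forest_sum G {#a, y#} \<alpha> * forest_sum G {#b, y#} \<alpha> - (split_sum G a {#y#} b \<alpha>)\<^sup>2"
proof -
  obtain src tgt where "\<And>e. e \<in> edges G \<Longrightarrow> ends G e = {src e, tgt e}"
    using wf unfolding wf_graph_def by metis
  then interpret oriented_graph G src tgt using wf by unfold_locales
  define X where "X = (\<lambda>u. split_sum G b {#y#} u \<alpha>)"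
  define Y where "Y = (\<lambda>u. split_sum G b {#a, y#} u \<alpha>)"
  define \<rho> where "\<rho> = (\<lambda>H. if conn (ends G) H a b then a else y)"
  have X: "X b = forest_sum G {#b, y#} \<alpha>" "X a = split_sum G a {#y#} b \<alpha>" "X y = 0"
    and Y: "Y b = forest_sum G {#a, b, y#} \<alpha>" "Y y = 0"
    using V by (auto simp: X_def Y_def split_sum_self split_sum_root_eq_0 split_sum_swap[of G b _ a]
        add_mset_commute)
  have "forest_sum G {#y#} \<alpha> * Y b = (\<Sum>e\<in>edges G. current b {#y#} \<alpha> e * (Y (src e) - Y (tgt e)))"
    using V Y(2) by (subst sum_current_differences[where \<rho> = "\<lambda>_. y"])
      (auto simp: forest_sum_def edge_sum_mult_right rooted_forest_def split: if_splits)
  also have "\<dots> = (\<Sum>e\<in>edges G. current b {#a, y#} \<alpha> e * (X (src e) - X (tgt e)))"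
    unfolding X_def Y_def by (intro sum.cong refl) (simp add: split_sum_src_diff_tgt mult_ac)
  also have "\<dots> = edge_sum (edges G) (\<lambda>H. of_bool (rooted_forest G {#a, y#} H) * (X b - X (\<rho> H))) \<alpha>"
    using V by (intro sum_current_differences)
      (auto simp: \<rho>_def rooted_forest_def split: if_splits)
  also have "\<dots> = edge_sum (edges G) (\<lambda>H. of_bool (rooted_forest G {#a, y#} H) * X b -
      of_bool (rooted_forest G {#a, y#} H \<and> conn (ends G) H a b) * X a) \<alpha>"
    by (intro edge_sum_cong) (simp add: \<rho>_def X(3) right_diff_distrib)
  also have "\<dots> = forest_sum G {#a, y#} \<alpha> * X b - split_sum G a {#y#} b \<alpha> * X a"
    by (simp only: edge_sum_diff edge_sum_mult_right forest_sum_def split_sum_def)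
  finally show ?thesis unfolding X Y by (simp add: power2_eq_square)
qed

section \<open>Deleting a vertex\<close>

definition incident :: "('v, 'e) multigraph \<Rightarrow> 'v \<Rightarrow> 'e set" where
  "incident G u = {e \<in> edges G. u \<in> ends G e}"

definition opposite :: "('v, 'e) multigraph \<Rightarrow> 'v \<Rightarrow> 'e \<Rightarrow> 'v" where
  "opposite G u e = (THE x. ends G e = {u, x})"

definition neighbour_mset :: "('v, 'e) multigraph \<Rightarrow> 'v \<Rightarrow> 'v multiset" where
  "neighbour_mset G u = image_mset (opposite G u) (mset_set (incident G u))"

lemma opposite_eq: "ends G e = {u, x} \<Longrightarrow> opposite G u e = x"
  unfolding opposite_def by (rule the_equality) (auto simp: doubleton_eq_iff)

lemma verts_delete_vertex [simp]: "verts (delete_vertex G v) = verts G - {v}"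
  and ends_delete_vertex [simp]: "ends (delete_vertex G v) = ends G"
  and edges_delete_vertex: "edges (delete_vertex G v) = {e \<in> edges G. v \<notin> ends G e}"
  by (simp_all add: delete_vertex_def)

lemma opposite_delete_vertex [simp]: "opposite (delete_vertex G v) = opposite G"
  by (simp add: opposite_def fun_eq_iff)

lemma incident_delete_vertex: "incident (delete_vertex G v) u = {e \<in> incident G u. v \<notin> ends G e}"
  by (auto simp: incident_def edges_delete_vertex)

lemma delete_vertex_commute:
  "delete_vertex (delete_vertex G v) w = delete_vertex (delete_vertex G w) v"
  by (rule multigraph.equality) (auto simp: delete_vertex_def)

lemma edges_eq_incident_Un: "edges G = incident G u \<union> edges (delete_vertex G u)"
  and incident_Int_edges_delete_vertex: "incident G u \<inter> edges (delete_vertex G u) = {}"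
  by (auto simp: incident_def edges_delete_vertex)

lemma wf_delete_vertex:
  assumes "wf_graph G"
  shows "wf_graph (delete_vertex G v)"
proof -
  have "\<exists>x\<in>verts G - {v}. \<exists>y\<in>verts G - {v}. ends G e = {x, y}"
    if e: "e \<in> edges G" "v \<notin> ends G e" for e
  proof -
    obtain x y where "x \<in> verts G" "y \<in> verts G" "ends G e = {x, y}"
      using assms e(1) unfolding wf_graph_def by blast
    then show ?thesis using e(2) by auto
  qed
  then show ?thesis using assms by (auto simp: wf_graph_def edges_delete_vertex)
qed

lemma forest_sum_loop:
  assumes wf: "wf_graph G" and a: "a \<in> verts G" "a \<notin># R"
    and e: "incident G a = {e}" "ends G e = {a}"
  shows "forest_sum G R \<alpha> = 0"
    and "forest_sum G (add_mset a R) \<alpha> = \<alpha> e * forest_sum (delete_vertex G a) R \<alpha>"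
proof -
  let ?E = "edges (delete_vertex G a)"
  have E: "edges G = insert e ?E" "e \<notin> ?E" "finite ?E"
    using edges_eq_incident_Un[of G a] incident_Int_edges_delete_vertex[of G a] e(1)
      wf_delete_vertex[OF wf] by (auto simp: wf_graph_def)
  have isolated: "a \<notin> ends G d" if "F \<subseteq> ?E" "d \<in> F" for F d
    using that by (auto simp: edges_delete_vertex)
  have "\<not> rooted_forest G R' (insert e F)" for R' F
    using forest_no_loop[of "ends G" "insert e F" e a] e(2) by (auto simp: rooted_forest_def)
  then have "forest_sum G R' \<alpha> = \<alpha> e * edge_sum ?E (\<lambda>F. of_bool (rooted_forest G R' F)) \<alpha>" for R'
    using E by (simp add: forest_sum_def edge_sum_insert edge_sum_eq_0)
  moreover have "edge_sum ?E (\<lambda>F. of_bool (rooted_forest G R F)) \<alpha> = 0"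
    using rooted_forest_isolated(1)[of _ a G R] isolated a by (intro edge_sum_eq_0) auto
  moreover have "edge_sum ?E (\<lambda>F. of_bool (rooted_forest G (add_mset a R) F)) \<alpha> =
      forest_sum (delete_vertex G a) R \<alpha>"
    unfolding forest_sum_def
    using rooted_forest_isolated(2)[of _ a G R] isolated a by (intro edge_sum_cong) auto
  ultimately show "forest_sum G R \<alpha> = 0"
    and "forest_sum G (add_mset a R) \<alpha> = \<alpha> e * forest_sum (delete_vertex G a) R \<alpha>"
    by simp_all
qed

locale loopless_vertex =
  fixes G :: "('v, 'e) multigraph" and w :: 'v
  assumes wf: "wf_graph G" and in_verts: "w \<in> verts G"
    and loopless: "e \<in> edges G \<Longrightarrow> ends G e \<noteq> {w}"
begin

abbreviation G' :: "('v, 'e) multigraph" where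
  "G' \<equiv> delete_vertex G w"

abbreviation opp :: "'e \<Rightarrow> 'v" where
  "opp \<equiv> opposite G w"

lemma finite_edges: "finite (edges G')" "finite (incident G w)"
  using wf by (auto simp: wf_graph_def edges_delete_vertex incident_def)

lemma incident_ends:
  assumes "e \<in> incident G w"
  shows "ends G e = {w, opp e}" "opp e \<in> verts G" "opp e \<noteq> w"
proof -
  have e: "e \<in> edges G" "w \<in> ends G e" using assms by (auto simp: incident_def)
  then obtain s t where "ends G e = {s, t}" "w \<in> {s, t}" using wf unfolding wf_graph_def by metis
  then obtain x where x: "ends G e = {w, x}" by (metis empty_iff insert_commute insert_iff)
  then have "opp e = x" by (rule opposite_eq)
  then show "ends G e = {w, opp e}" "opp e \<in> verts G" "opp e \<noteq> w"
    using x ends_subset_verts[OF wf e(1)] loopless[OF e(1)] by auto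
qed

lemma not_incident: "F \<subseteq> edges G' \<Longrightarrow> e \<in> F \<Longrightarrow> w \<notin> ends G e"
  by (auto simp: edges_delete_vertex)

lemma rooted_forest_union_incident:
  assumes S: "S \<subseteq> incident G w" and F: "F \<subseteq> edges G'" and R: "w \<notin># R"
  shows "rooted_forest G (add_mset w R) (S \<union> F) \<longleftrightarrow>
    rooted_forest G' (image_mset opp (mset_set S) + R) F"
proof -
  have "finite S" using S finite_edges(2) finite_subset by blast
  moreover have "S \<inter> F = {}" using S F incident_Int_edges_delete_vertex[of G w] by blast
  ultimately have "rooted_forest G (add_mset w R) (S \<union> F) \<longleftrightarrow>
      rooted_forest G (add_mset w (image_mset opp (mset_set S) + R)) F"
    using S incident_ends in_verts by (intro rooted_forest_star) auto
  moreover have "w \<notin># image_mset opp (mset_set S) + R"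
    using R S \<open>finite S\<close> incident_ends(3) by fastforce
  ultimately show ?thesis
    using rooted_forest_isolated(2)[OF not_incident[OF F] in_verts] by simp
qed

lemma forest_sum_root_expansion:
  assumes "w \<notin># R"
  shows "forest_sum G (add_mset w R) \<alpha> = (\<Sum>S\<in>Pow (incident G w).
    prod \<alpha> (incident G w - S) * forest_sum G' (image_mset opp (mset_set S) + R) \<alpha>)"
  unfolding forest_sum_def[of G] edges_eq_incident_Un[of G w]
    edge_sum_Un[OF finite_edges(2,1) incident_Int_edges_delete_vertex]
  by (intro sum.cong refl arg_cong2[of _ _ _ _ "(*)"])
    (simp add: forest_sum_def rooted_forest_union_incident[OF _ _ assms] cong: edge_sum_cong)

lemma rooted_forest_insert_incident:
  assumes e: "e \<in> incident G w" and F: "F \<subseteq> edges G'" and R: "w \<notin># R"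
  shows "rooted_forest G R (insert e F) \<longleftrightarrow> rooted_forest G' R F"
    and "rooted_forest G (add_mset w R) (insert e F) \<longleftrightarrow> rooted_forest G' (add_mset (opp e) R) F"
    and "u \<noteq> w \<Longrightarrow> conn (ends G) (insert e F) w u \<longleftrightarrow> conn (ends G) F (opp e) u"
proof -
  show "rooted_forest G R (insert e F) \<longleftrightarrow> rooted_forest G' R F"
    using rooted_forest_pendant[OF not_incident[OF F] incident_ends(1)[OF e] in_verts] R
      incident_ends[OF e] by simp
  show "rooted_forest G (add_mset w R) (insert e F) \<longleftrightarrow> rooted_forest G' (add_mset (opp e) R) F"
    using rooted_forest_union_incident[of "{e}", OF _ F R] e by simp
  show "conn (ends G) (insert e F) w u \<longleftrightarrow> conn (ends G) F (opp e) u" if "u \<noteq> w"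
    using that conn_insert[of "ends G" e w "opp e" F] incident_ends[OF e]
      conn_isolated[of F w "ends G"] not_incident[OF F] by auto
qed

lemma edge_sum_degree_1:
  assumes "incident G w = {e}" "\<And>F. F \<subseteq> edges G' \<Longrightarrow> f F = 0"
  shows "edge_sum (edges G) f \<alpha> = edge_sum (edges G') (\<lambda>F. f (insert e F)) \<alpha>"
  using assms edges_eq_incident_Un[of G w] incident_Int_edges_delete_vertex[of G w] finite_edges(1)
  by (simp add: edge_sum_insert edge_sum_eq_0)

lemma edge_sum_degree_2:
  assumes "incident G w = {e, e'}" "e \<noteq> e'" "\<And>F. F \<subseteq> edges G' \<Longrightarrow> f F = 0"
  shows "edge_sum (edges G) f (\<alpha>(e := x, e' := y)) =
    y * edge_sum (edges G') (\<lambda>F. f (insert e F)) \<alpha> +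
    x * edge_sum (edges G') (\<lambda>F. f (insert e' F)) \<alpha> +
    edge_sum (edges G') (\<lambda>F. f (insert e (insert e' F))) \<alpha>"
proof -
  have "edges G = insert e (insert e' (edges G'))" "e \<notin> edges G'" "e' \<notin> edges G'"
    using assms(1) edges_eq_incident_Un[of G w] incident_Int_edges_delete_vertex[of G w] by auto
  then show ?thesis
    using finite_edges(1) assms(2,3) by (simp add: edge_sum_insert edge_sum_eq_0)
qed

lemma not_rooted_forest_without_incident:
  "F \<subseteq> edges G' \<Longrightarrow> w \<notin># R \<Longrightarrow> \<not> rooted_forest G R F"
  using rooted_forest_isolated(1)[of F w G R] not_incident in_verts by blast

lemma not_conn_without_incident:
  "F \<subseteq> edges G' \<Longrightarrow> u \<noteq> w \<Longrightarrow> \<not> conn (ends G) F w u"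
  using conn_isolated(1)[of F w "ends G" u] not_incident by blast

lemma forest_sum_degree_1:
  assumes e: "incident G w = {e}" and R: "w \<notin># R"
  shows "forest_sum G R \<alpha> = forest_sum G' R \<alpha>"
    and "forest_sum G (add_mset w R) \<alpha> =
      \<alpha> e * forest_sum G' R \<alpha> + forest_sum G' (add_mset (opp e) R) \<alpha>"
proof -
  show "forest_sum G R \<alpha> = forest_sum G' R \<alpha>"
    unfolding forest_sum_def using e R
    by (subst edge_sum_degree_1[OF e])
      (auto simp: not_rooted_forest_without_incident rooted_forest_insert_incident
        intro: edge_sum_cong)
  have "Pow {e} = {{}, {e}}" by auto
  then show "forest_sum G (add_mset w R) \<alpha> =
      \<alpha> e * forest_sum G' R \<alpha> + forest_sum G' (add_mset (opp e) R) \<alpha>"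
    using forest_sum_root_expansion[OF R, of \<alpha>] e by simp
qed

lemma split_sum_degree_1:
  assumes e: "incident G w = {e}" and "w \<notin># R" "u \<noteq> w"
  shows "split_sum G w R u \<alpha> = split_sum G' (opp e) R u \<alpha>"
  unfolding split_sum_def using assms
  by (subst edge_sum_degree_1[OF e])
    (auto simp: not_conn_without_incident rooted_forest_insert_incident intro: edge_sum_cong)

lemma forest_sum_degree_2:
  fixes R :: "'v multiset"
  assumes e: "incident G w = {e, e'}" "e \<noteq> e'" and R: "w \<notin># R"
  obtains \<kappa> :: "('e \<Rightarrow> 'a::comm_ring_1) \<Rightarrow> 'a"
  where "\<And>\<alpha> x y. forest_sum G R (\<alpha>(e := x, e' := y)) = (x + y) * forest_sum G' R \<alpha> + \<kappa> \<alpha>"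
proof
  fix \<alpha> :: "'e \<Rightarrow> 'a" and x y
  have "edge_sum (edges G') (\<lambda>F. of_bool (rooted_forest G R (insert d F))) \<alpha> = forest_sum G' R \<alpha>"
    if "d \<in> {e, e'}" for d
    unfolding forest_sum_def using that e R
    by (intro edge_sum_cong) (simp add: rooted_forest_insert_incident)
  then show "forest_sum G R (\<alpha>(e := x, e' := y)) = (x + y) * forest_sum G' R \<alpha> +
      edge_sum (edges G') (\<lambda>F. of_bool (rooted_forest G R (insert e (insert e' F)))) \<alpha>"
    unfolding forest_sum_def[of G] using R
    by (subst edge_sum_degree_2[OF e])
      (simp_all add: not_rooted_forest_without_incident algebra_simps)
qed

lemma split_sum_degree_2:
  fixes R :: "'v multiset"
  assumes e: "incident G w = {e, e'}" "e \<noteq> e'" and R: "w \<notin># R" and u: "u \<noteq> w"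
  obtains \<kappa> :: "('e \<Rightarrow> 'a::comm_ring_1) \<Rightarrow> 'a"
  where "\<And>\<alpha> x y. split_sum G w R u (\<alpha>(e := x, e' := y)) =
    y * split_sum G' (opp e) R u \<alpha> + x * split_sum G' (opp e') R u \<alpha> + \<kappa> \<alpha>"
proof
  fix \<alpha> :: "'e \<Rightarrow> 'a" and x y
  let ?f = "\<lambda>F. of_bool (rooted_forest G (add_mset w R) F \<and> conn (ends G) F w u) :: 'a"
  have "edge_sum (edges G') (\<lambda>F. ?f (insert d F)) \<alpha> = split_sum G' (opp d) R u \<alpha>"
    if "d \<in> {e, e'}" for d
    unfolding split_sum_def using that e R u
    by (intro edge_sum_cong) (simp add: rooted_forest_insert_incident)
  then show "split_sum G w R u (\<alpha>(e := x, e' := y)) =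
      y * split_sum G' (opp e) R u \<alpha> + x * split_sum G' (opp e') R u \<alpha> +
      edge_sum (edges G') (\<lambda>F. ?f (insert e (insert e' F))) \<alpha>"
    unfolding split_sum_def[of G] using R u
    by (subst edge_sum_degree_2[OF e]) (simp_all add: not_conn_without_incident)
qed

lemma degree_eq_card_incident: "degree G w = card (incident G w)"
proof -
  have "{e \<in> edges G. ends G e = {w}} = {}" using loopless by blast
  then show ?thesis by (simp only: degree_def incident_def card.empty add_0_right)
qed

lemma count_neighbour_mset: "count (neighbour_mset G w) u = card {e \<in> incident G w. opp e = u}"
proof -
  have "opp -` {u} \<inter> incident G w = {e \<in> incident G w. opp e = u}" by auto
  then show ?thesis using finite_edges(2) by (simp add: neighbour_mset_def count_image_mset)
qed

lemma degree_delete_vertex: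
  assumes "u \<noteq> w"
  shows "degree G u = degree G' u + count (neighbour_mset G w) u"
proof -
  have "{e \<in> edges G. u \<in> ends G e} =
      {e \<in> edges G'. u \<in> ends G e} \<union> {e \<in> incident G w. opp e = u}"
    using assms incident_ends(1) by (auto simp: incident_def edges_delete_vertex)
  moreover have "{e \<in> edges G'. u \<in> ends G e} \<inter> {e \<in> incident G w. opp e = u} = {}"
    using incident_Int_edges_delete_vertex[of G w] by blast
  moreover have "{e \<in> edges G. ends G e = {u}} = {e \<in> edges G'. ends G e = {u}}"
    using assms by (auto simp: edges_delete_vertex)
  ultimately show ?thesis
    using finite_edges by (simp add: degree_def card_Un_disjoint count_neighbour_mset)
qed

lemma neighbour_mset_in_verts: "u \<in># neighbour_mset G w \<Longrightarrow> u \<in> verts G'"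
  using incident_ends finite_edges(2) by (auto simp: neighbour_mset_def)

lemma neighbour_mset_delete_vertex:
  assumes "u \<noteq> w"
  shows "neighbour_mset (delete_vertex G u) w = filter_mset (\<lambda>z. z \<noteq> u) (neighbour_mset G w)"
proof -
  have "incident (delete_vertex G u) w = {e \<in> incident G w. opp e \<noteq> u}"
    using assms incident_ends(1) by (auto simp: incident_delete_vertex)
  then show ?thesis
    using finite_edges(2)
    by (simp add: neighbour_mset_def filter_mset_image_mset filter_mset_mset_set)
qed

lemma delete_other_vertex: "u \<noteq> w \<Longrightarrow> loopless_vertex (delete_vertex G u) w"
  using wf_delete_vertex[OF wf] in_verts loopless
  by unfold_locales (auto simp: edges_delete_vertex)

end

lemma finite_incident: "wf_graph G \<Longrightarrow> finite (incident G u)"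
  by (simp add: incident_def wf_graph_def)

lemma degree_eq_1E:
  assumes "wf_graph G" "u \<in> verts G" "degree G u = 1"
  obtains e where "loopless_vertex G u" "incident G u = {e}"
proof -
  have "card {e \<in> edges G. ends G e = {u}} \<le> card (incident G u)"
    using finite_incident[OF assms(1)] by (intro card_mono) (auto simp: incident_def)
  then have "card (incident G u) = 1" "card {e \<in> edges G. ends G e = {u}} = 0"
    using assms(3) by (auto simp: degree_def incident_def)
  moreover from this have "loopless_vertex G u"
    using assms by unfold_locales (auto simp: wf_graph_def)
  ultimately show ?thesis using that by (auto simp: card_1_singleton_iff)
qed

lemma degree_eq_2_cases:
  assumes "wf_graph G" "u \<in> verts G" "degree G u = 2"
  obtains (loop) e where "incident G u = {e}" "ends G e = {u}"
    | (edges) e e' where "loopless_vertex G u" "incident G u = {e, e'}" "e \<noteq> e'"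
proof (cases "\<exists>d\<in>edges G. ends G d = {u}")
  case True
  then obtain d where d: "d \<in> edges G" "ends G d = {u}" by blast
  have "finite {e \<in> edges G. ends G e = {u}}" using assms(1) by (simp add: wf_graph_def)
  then have "card {e \<in> edges G. ends G e = {u}} > 0" using d by (auto simp: card_gt_0_iff)
  moreover have "card {e \<in> edges G. ends G e = {u}} \<le> card (incident G u)"
    using finite_incident[OF assms(1)] by (intro card_mono) (auto simp: incident_def)
  ultimately have "card (incident G u) = 1" using assms(3) by (simp add: degree_def incident_def)
  moreover have "d \<in> incident G u" using d by (simp add: incident_def)
  ultimately show ?thesis using loop[of d] d(2) by (auto simp: card_1_singleton_iff)
next
  case False
  then have "loopless_vertex G u" using assms by unfold_locales auto
  then show ?thesis
    using edges assms(3) by (auto simp: loopless_vertex.degree_eq_card_incident card_2_iff)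
qed

section \<open>Counting zeros modulo a prime\<close>

definition zero_mod :: "int \<Rightarrow> int \<Rightarrow> int" where
  "zero_mod q n = of_bool (q dvd n)"

definition nonzero_mod :: "int \<Rightarrow> int \<Rightarrow> int" where
  "nonzero_mod q n = of_bool (\<not> q dvd n)"

lemma zero_mod_0 [simp]: "zero_mod q 0 = 1"
  by (simp add: zero_mod_def)

lemma nonzero_mod_eq: "nonzero_mod q n = 1 - zero_mod q n"
  by (simp add: nonzero_mod_def zero_mod_def)

lemma zero_mod_cong: "[m = n] (mod q) \<Longrightarrow> zero_mod q m = zero_mod q n"
  by (simp add: zero_mod_def cong_dvd_iff)

lemma nonzero_mod_cong: "[m = n] (mod q) \<Longrightarrow> nonzero_mod q m = nonzero_mod q n"
  by (simp add: nonzero_mod_def cong_dvd_iff)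

lemma zero_mod_add_multiple: "q dvd m \<Longrightarrow> zero_mod q (m + n) = zero_mod q n"
  by (simp add: zero_mod_def dvd_add_right_iff)

lemma sum_affine_zeros:
  assumes q: "prime q"
  shows "(\<Sum>x\<in>{0..<q}. zero_mod q (b * x + a)) =
    1 - zero_mod q b + q * (zero_mod q b * zero_mod q a)"
proof (cases "q dvd b")
  case True
  then have "zero_mod q (b * x + a) = zero_mod q a" for x by (simp add: zero_mod_add_multiple)
  then show ?thesis using True prime_gt_0_int[OF q] by (simp add: zero_mod_def)
next
  case False
  have coprime: "coprime b q"
    using prime_imp_coprime[OF q False] by (simp add: coprime_commute)
  obtain x0 where x0: "[b * x0 = - a] (mod q)" using cong_solve_coprime_int[OF coprime]
    by (metis cong_scalar_right mult.assoc mult.left_neutral)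
  have "q dvd b * x + a \<longleftrightarrow> x = x0 mod q" if x: "x \<in> {0..<q}" for x
  proof -
    have "q dvd b * x + a \<longleftrightarrow> [b * x = - a] (mod q)" by (simp add: cong_iff_dvd_diff)
    also have "\<dots> \<longleftrightarrow> [b * x = b * x0] (mod q)" using x0 cong_trans cong_sym by metis
    also have "\<dots> \<longleftrightarrow> [x = x0] (mod q)" using coprime by (simp add: cong_mult_lcancel)
    also have "\<dots> \<longleftrightarrow> x = x0 mod q" using x by (simp add: cong_def)
    finally show ?thesis .
  qed
  then have "(\<Sum>x\<in>{0..<q}. zero_mod q (b * x + a)) = (\<Sum>x\<in>{0..<q}. if x = x0 mod q then 1 else 0)"
    by (intro sum.cong) (auto simp: zero_mod_def)
  then show ?thesis using False prime_gt_0_int[OF q] by (simp add: zero_mod_def)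
qed

lemma sum_affine_zeros_cong:
  assumes "prime q"
  shows "[(\<Sum>x\<in>{0..<q}. zero_mod q (b * x + a)) = nonzero_mod q b] (mod q)"
  by (simp add: sum_affine_zeros[OF assms] nonzero_mod_eq cong_iff_dvd_diff)

lemma sum_affine_nonzeros_cong:
  assumes "prime q"
  shows "[(\<Sum>x\<in>{0..<q}. nonzero_mod q (b * x + a)) = - nonzero_mod q b] (mod q)"
  using prime_gt_0_int[OF assms]
  by (simp add: nonzero_mod_eq sum_subtractf sum_affine_zeros[OF assms] cong_iff_dvd_diff)

lemma sum_affine_nonzeros_mult_cong:
  assumes "prime q"
  shows "[(\<Sum>x\<in>{0..<q}. nonzero_mod q b * nonzero_mod q (b * x + a)) = - nonzero_mod q b] (mod q)"
proof -
  have "[nonzero_mod q b * (\<Sum>x\<in>{0..<q}. nonzero_mod q (b * x + a)) =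
      nonzero_mod q b * - nonzero_mod q b] (mod q)"
    by (intro cong_mult cong_refl sum_affine_nonzeros_cong assms)
  moreover have "nonzero_mod q b * - nonzero_mod q b = - nonzero_mod q b"
    by (simp add: nonzero_mod_def)
  ultimately show ?thesis by (simp only: sum_distrib_left)
qed

lemma sum_pair_periodic:
  fixes q :: int
  assumes "\<And>s x. h (s mod q) x = h s x"
  shows "(\<Sum>x\<in>{0..<q}. \<Sum>y\<in>{0..<q}. h (x + y) x) = (\<Sum>s\<in>{0..<q}. \<Sum>x\<in>{0..<q}. h s x)"
proof -
  have "(\<Sum>y\<in>{0..<q}. h (x + y) x) = (\<Sum>s\<in>{0..<q}. h s x)" for x
    by (rule sum.reindex_bij_witness[where j = "\<lambda>y. (x + y) mod q" and i = "\<lambda>s. (s - x) mod q"])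
      (auto simp: mod_diff_left_eq mod_add_right_eq assms)
  then show ?thesis by (simp add: sum.swap[of h])
qed

lemma dvd_sum_pair_periodic:
  fixes q :: int
  assumes "\<And>s. h (s mod q) = h s"
  shows "q dvd (\<Sum>x\<in>{0..<q}. \<Sum>y\<in>{0..<q}. h (x + y))"
proof -
  have "(\<Sum>x\<in>{0..<q}. \<Sum>y\<in>{0..<q}. h (x + y)) = (\<Sum>s\<in>{0..<q}. q * h s)"
    using sum_pair_periodic[of "\<lambda>s x. h s"] assms by (cases "q \<ge> 0") simp_all
  then show ?thesis by (simp add: sum_distrib_left[symmetric])
qed

text \<open>
  Substituting \<open>s = x + y\<close> makes the first factor independent of \<open>x\<close>, while the second one becomes
  affine in \<open>x\<close> with leading coefficient \<open>d - c\<close>.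
\<close>

lemma sum_pair_affine_cong:
  fixes q :: int
  assumes periodic: "\<And>m n. [m = n] (mod q) \<Longrightarrow> \<chi> m = \<chi> n"
    and sum: "\<And>b a. [(\<Sum>x\<in>{0..<q}. \<chi> (b * x + a)) = \<epsilon> * nonzero_mod q b] (mod q)"
    and "\<epsilon> * \<epsilon> = 1"
  shows "[(\<Sum>x\<in>{0..<q}. \<Sum>y\<in>{0..<q}. \<chi> ((x + y) * t + t') * \<chi> (y * c + x * d + k)) =
    nonzero_mod q t * nonzero_mod q (d - c)] (mod q)"
proof -
  let ?Q = "{0..<q}"
  define h where "h = (\<lambda>s x. \<chi> (s * t + t') * \<chi> ((s - x) * c + x * d + k))"
  have "h (s mod q) x = h s x" for s x
    unfolding h_def
    by (intro arg_cong2[of _ _ _ _ "(*)"] periodic cong_add cong_mult cong_diff cong_refl)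
      (simp_all add: cong_def)
  then have "(\<Sum>x\<in>?Q. \<Sum>y\<in>?Q. \<chi> ((x + y) * t + t') * \<chi> (y * c + x * d + k)) =
      (\<Sum>s\<in>?Q. \<Sum>x\<in>?Q. h s x)"
    using sum_pair_periodic[of h q] by (simp add: h_def)
  also have "\<dots> = (\<Sum>s\<in>?Q. \<chi> (t * s + t') * (\<Sum>x\<in>?Q. \<chi> ((d - c) * x + (s * c + k))))"
    unfolding h_def sum_distrib_left by (intro sum.cong refl) (simp add: algebra_simps)
  finally have inner: "[(\<Sum>x\<in>?Q. \<Sum>y\<in>?Q. \<chi> ((x + y) * t + t') * \<chi> (y * c + x * d + k)) =
      (\<Sum>s\<in>?Q. \<chi> (t * s + t') * (\<epsilon> * nonzero_mod q (d - c)))] (mod q)"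
    by (simp only:) (intro cong_sum cong_mult cong_refl sum)
  have outer: "[(\<Sum>s\<in>?Q. \<chi> (t * s + t') * (\<epsilon> * nonzero_mod q (d - c))) =
      \<epsilon> * nonzero_mod q t * (\<epsilon> * nonzero_mod q (d - c))] (mod q)"
    unfolding sum_distrib_right[symmetric] by (intro cong_mult cong_refl sum)
  have "\<epsilon> * nonzero_mod q t * (\<epsilon> * nonzero_mod q (d - c)) =
      nonzero_mod q t * nonzero_mod q (d - c)"
  proof -
    have "\<epsilon> * m * (\<epsilon> * n) = \<epsilon> * \<epsilon> * (m * n)" for m n by (simp add: mult_ac)
    then show ?thesis by (simp only: assms(3) mult_1_left)
  qed
  with cong_trans[OF inner outer] show ?thesis by (simp only:)
qed

lemma sum_affine_zeros_triple:
  assumes q: "prime q"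
  shows "(\<Sum>x\<in>{0..<q}. \<Sum>y\<in>{0..<q}. \<Sum>z\<in>{0..<q}. zero_mod q (c x y * z + d x y)) =
    q\<^sup>2 - (\<Sum>x\<in>{0..<q}. \<Sum>y\<in>{0..<q}. zero_mod q (c x y)) +
    q * (\<Sum>x\<in>{0..<q}. \<Sum>y\<in>{0..<q}. zero_mod q (c x y) * zero_mod q (d x y))"
  using prime_gt_0_int[OF q]
  by (simp add: sum_affine_zeros[OF q] sum.distrib sum_subtractf sum_distrib_left power2_eq_square)

definition cone_zeros :: "int \<Rightarrow> int \<Rightarrow> int \<Rightarrow> int \<Rightarrow> int \<Rightarrow> int \<Rightarrow> int" where
  "cone_zeros q t f13 f23 f3 f = (\<Sum>x\<in>{0..<q}. \<Sum>y\<in>{0..<q}. \<Sum>z\<in>{0..<q}.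
     zero_mod q ((t * (x + y) + (f13 + f23 - 2 * f3)) * z + (t * x * y + f23 * x + f13 * y + f)))"

lemma cone_zeros_nondegenerate:
  assumes q: "prime q" and t: "\<not> q dvd t" and cone: "t * f = f13 * f23 - f3\<^sup>2"
  shows "cone_zeros q t f13 f23 f3 f = q\<^sup>2"
proof -
  let ?Q = "{0..<q}"
  define c where "c = (\<lambda>x y. t * (x + y) + (f13 + f23 - 2 * f3))"
  define d where "d = (\<lambda>x y. t * x * y + f23 * x + f13 * y + f)"
  have t0: "zero_mod q t = 0" using t by (simp add: zero_mod_def)
  have sum_c: "(\<Sum>y\<in>?Q. zero_mod q (c x y)) = 1" for x
  proof -
    have "c x y = t * y + (t * x + (f13 + f23 - 2 * f3))" for y by (simp add: c_def algebra_simps)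
    then show ?thesis by (simp add: sum_affine_zeros[OF q] t0)
  qed
  \<comment> \<open>On the line where the coefficient \<open>c\<close> of \<open>z\<close> vanishes, completing the square
    turns \<open>t * d\<close> into minus the square of \<open>t * x + f13 - f3\<close>.\<close>
  have square: "zero_mod q (c x y) * zero_mod q (d x y) =
      zero_mod q (c x y) * zero_mod q (t * x + (f13 - f3))" for x y
  proof (cases "q dvd c x y")
    case True
    let ?l = "t * x + (f13 - f3)"
    have "t * d x y = c x y * (?l + f3) + (t * f - (f13 * f23 - f3\<^sup>2)) - ?l\<^sup>2"
      by (simp add: c_def d_def algebra_simps power2_eq_square)
    then have "t * d x y = c x y * (?l + f3) - ?l\<^sup>2" using cone by simp
    then have "q dvd t * d x y \<longleftrightarrow> q dvd ?l\<^sup>2" using True by (simp add: dvd_diff_right_iff)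
    then have "q dvd d x y \<longleftrightarrow> q dvd ?l"
      using t q by (simp add: prime_dvd_mult_iff prime_dvd_power_iff)
    then show ?thesis by (simp add: zero_mod_def)
  qed (simp add: zero_mod_def)
  have "(\<Sum>x\<in>?Q. \<Sum>y\<in>?Q. zero_mod q (c x y) * zero_mod q (d x y)) = 1"
    by (simp add: square sum_distrib_right[symmetric] sum_c sum_affine_zeros[OF q] t0)
  then show ?thesis
    using sum_affine_zeros_triple[OF q, of c d] sum_c prime_gt_0_int[OF q]
    by (simp add: cone_zeros_def c_def d_def)
qed

lemma cone_zeros_degenerate:
  assumes q: "prime q" and t: "q dvd t" and cone: "t * f = f13 * f23 - f3\<^sup>2"
  shows "cone_zeros q t f13 f23 f3 f =
    q\<^sup>2 * (1 - zero_mod q f13 * zero_mod q f23 * (1 - q * zero_mod q f))"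
proof -
  let ?Q = "{0..<q}"
  have q0: "q > 0" using prime_gt_0_int[OF q] .
  have coeff: "zero_mod q (t * (x + y) + n) = zero_mod q n" for x y n
    using t by (simp add: zero_mod_add_multiple)
  have const: "zero_mod q (t * x * y + f23 * x + f13 * y + f) =
      zero_mod q (f13 * y + (f23 * x + f))" for x y
    using t zero_mod_add_multiple[of q "t * x * y" "f13 * y + (f23 * x + f)"] by (simp add: add_ac)
  have pairs: "(\<Sum>x\<in>?Q. \<Sum>y\<in>?Q. zero_mod q (f13 * y + (f23 * x + f))) =
      q * (1 - zero_mod q f13 * zero_mod q f23 * (1 - q * zero_mod q f))"
    unfolding sum_affine_zeros[OF q] sum.distrib sum_distrib_left[symmetric]
    using q0 by (simp add: algebra_simps)
  have "q dvd f13 + f23 - 2 * f3" if "q dvd f13" "q dvd f23"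
  proof -
    have "q dvd t * f" "q dvd f13 * f23" using t that(1) by simp_all
    then have "q dvd f3\<^sup>2" using cone by (metis dvd_diff_right_iff)
    then show ?thesis using that prime_dvd_power[OF q] by simp
  qed
  then show ?thesis
    unfolding cone_zeros_def sum_affine_zeros_triple[OF q] coeff const
      sum_distrib_left[symmetric] pairs
    using q0 by (auto simp: zero_mod_def power2_eq_square algebra_simps)
qed

lemma cone_zeros_eq:
  assumes q: "prime q" and "t * f = f13 * f23 - f3\<^sup>2"
  shows "cone_zeros q t f13 f23 f3 f =
    q\<^sup>2 * (1 - zero_mod q t * zero_mod q f13 * zero_mod q f23 * (1 - q * zero_mod q f))"
proof (cases "q dvd t")
  case True
  then show ?thesis using cone_zeros_degenerate[OF q _ assms(2)] by (simp add: zero_mod_def)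
next
  case False
  then show ?thesis using cone_zeros_nondegenerate[OF q _ assms(2)] by (simp add: zero_mod_def)
qed

section \<open>Counting points of a graph with a vertex of small degree\<close>

abbreviation points :: "int \<Rightarrow> ('v, 'e) multigraph \<Rightarrow> ('e \<Rightarrow> int) set" where
  "points q G \<equiv> edges G \<rightarrow>\<^sub>E {0..<q}"

definition common_zeros :: "int \<Rightarrow> ('v, 'e) multigraph \<Rightarrow> 'v \<Rightarrow> 'v \<Rightarrow> 'v \<Rightarrow> int" where
  "common_zeros q G a b y = (\<Sum>\<alpha>\<in>points q G. zero_mod q (kirchhoff G \<alpha>) *
     zero_mod q (forest_sum G {#a, y#} \<alpha>) * zero_mod q (forest_sum G {#b, y#} \<alpha>))"

definition split_zeros :: "int \<Rightarrow> ('v, 'e) multigraph \<Rightarrow> 'v \<Rightarrow> 'v \<Rightarrow> 'v \<Rightarrow> int" where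
  "split_zeros q G a b y = (\<Sum>\<alpha>\<in>points q G. zero_mod q (kirchhoff G \<alpha>) *
     zero_mod q (split_sum G a {#y#} b \<alpha>))"

definition split_diff_nonzeros ::
    "int \<Rightarrow> ('v, 'e) multigraph \<Rightarrow> 'v \<Rightarrow> 'v \<Rightarrow> 'v \<Rightarrow> 'v \<Rightarrow> int" where
  "split_diff_nonzeros q G b u u' y = (\<Sum>\<alpha>\<in>points q G. nonzero_mod q (kirchhoff G \<alpha>) *
     nonzero_mod q (split_sum G b {#y#} u \<alpha> - split_sum G b {#y#} u' \<alpha>))"

lemma common_zeros_commute: "common_zeros q G a b y = common_zeros q G b a y"
  by (simp add: common_zeros_def mult_ac)

lemma split_diff_nonzeros_commute:
  "split_diff_nonzeros q G b u u' y = split_diff_nonzeros q G b u' u y"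
  by (simp add: split_diff_nonzeros_def nonzero_mod_def dvd_diff_commute)

lemma split_diff_nonzeros_self: "split_diff_nonzeros q G b u u y = 0"
  by (simp add: split_diff_nonzeros_def nonzero_mod_def)

lemma sum_PiE_insert:
  assumes "e \<notin> E"
  shows "(\<Sum>\<alpha>\<in>insert e E \<rightarrow>\<^sub>E S. \<phi> \<alpha>) = (\<Sum>\<alpha>\<in>E \<rightarrow>\<^sub>E S. \<Sum>x\<in>S. \<phi> (\<alpha>(e := x)))"
proof -
  have "(\<Sum>\<alpha>\<in>insert e E \<rightarrow>\<^sub>E S. \<phi> \<alpha>) = (\<Sum>(x, \<alpha>)\<in>S \<times> (E \<rightarrow>\<^sub>E S). \<phi> (\<alpha>(e := x)))"
    unfolding PiE_insert_eq using inj_combinator[OF assms, of "\<lambda>_. S"]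
    by (subst sum.reindex) (auto simp: case_prod_unfold)
  also have "\<dots> = (\<Sum>x\<in>S. \<Sum>\<alpha>\<in>E \<rightarrow>\<^sub>E S. \<phi> (\<alpha>(e := x)))"
    by (simp add: sum.cartesian_product)
  finally show ?thesis by (simp add: sum.swap[of _ S])
qed

lemma sum_Pow_insert:
  assumes "finite A" "e \<notin> A"
  shows "(\<Sum>S\<in>Pow (insert e A). f S) = (\<Sum>S\<in>Pow A. f S) + (\<Sum>S\<in>Pow A. f (insert e S))"
proof -
  have "(\<Sum>S\<in>Pow (insert e A). f S) = (\<Sum>S\<in>Pow A. f S) + (\<Sum>S\<in>insert e ` Pow A. f S)"
    unfolding Pow_insert using assms by (intro sum.union_disjoint) auto
  moreover have "inj_on (insert e) (Pow A)" using assms(2) by (auto simp: inj_on_def)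
  ultimately show ?thesis by (simp add: sum.reindex)
qed

context loopless_vertex
begin

lemma sum_points_degree_1:
  assumes "incident G w = {e}"
  shows "(\<Sum>\<alpha>\<in>points q G. \<phi> \<alpha>) = (\<Sum>\<alpha>\<in>points q G'. \<Sum>x\<in>{0..<q}. \<phi> (\<alpha>(e := x)))"
  using assms edges_eq_incident_Un[of G w] incident_Int_edges_delete_vertex[of G w]
  by (simp add: sum_PiE_insert)

lemma sum_points_degree_2:
  assumes "incident G w = {e, e'}" "e \<noteq> e'"
  shows "(\<Sum>\<alpha>\<in>points q G. \<phi> \<alpha>) =
    (\<Sum>\<alpha>\<in>points q G'. \<Sum>x\<in>{0..<q}. \<Sum>y\<in>{0..<q}. \<phi> (\<alpha>(e := x, e' := y)))"
proof -
  have E: "edges G = insert e' (insert e (edges G'))" "e' \<notin> insert e (edges G')" "e \<notin> edges G'"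
    using assms edges_eq_incident_Un[of G w] incident_Int_edges_delete_vertex[of G w] by auto
  show ?thesis unfolding E(1) sum_PiE_insert[OF E(2)] sum_PiE_insert[OF E(3)] ..
qed

lemma kirchhoff_delete_vertex: "r \<in> verts G' \<Longrightarrow> kirchhoff G' \<alpha> = forest_sum G' {#r#} \<alpha>"
  by (rule kirchhoff_eq_forest_sum[OF wf_delete_vertex[OF wf]])

lemma kirchhoff_eq_forest_sum_opposite:
  assumes "e \<in> incident G w"
  shows "kirchhoff G \<alpha> = forest_sum G {#opp e#} \<alpha>"
    and "kirchhoff G' \<alpha> = forest_sum G' {#opp e#} \<alpha>"
  using incident_ends[OF assms]
  by (simp_all add: kirchhoff_eq_forest_sum[OF wf] kirchhoff_delete_vertex)

lemma kirchhoff_degree_1: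
  fixes \<alpha> :: "'e \<Rightarrow> 'a::comm_ring_1"
  assumes e: "incident G w = {e}"
  shows "kirchhoff G \<alpha> = kirchhoff G' \<alpha>"
  using kirchhoff_eq_forest_sum_opposite[of e \<alpha>] forest_sum_degree_1(1)[OF e, of "{#opp e#}" \<alpha>] e
    incident_ends(3)[of e] by simp

lemma kirchhoff_degree_2:
  assumes e: "incident G w = {e, e'}" "e \<noteq> e'"
  shows "kirchhoff G (\<alpha>(e := x, e' := y)) =
    (x + y) * kirchhoff G' \<alpha> + forest_sum G' {#opp e, opp e'#} \<alpha>"
proof -
  have "e \<notin> edges G'" "e' \<notin> edges G'" "verts G' \<noteq> {}"
    using e incident_Int_edges_delete_vertex[of G w] incident_ends[of e] by auto
  then show ?thesis
    using e forest_sum_root_expansion[of "{#}" "\<alpha>(e := x, e' := y)"]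
    by (simp add: kirchhoff_eq_forest_sum[OF wf in_verts] sum_Pow_insert insert_Diff_if
        forest_sum_no_root_eq_0 kirchhoff_eq_forest_sum_opposite(2)[of e]
        kirchhoff_eq_forest_sum_opposite(2)[of e', symmetric] algebra_simps)
qed

lemma kirchhoff_degree_3:
  assumes e: "incident G w = {e1, e2, e3}" "distinct [e1, e2, e3]"
  shows "kirchhoff G (\<alpha>(e1 := x, e2 := y, e3 := z)) =
    (kirchhoff G' \<alpha> * (x + y) + forest_sum G' {#opp e1, opp e2#} \<alpha>) * z +
    (kirchhoff G' \<alpha> * x * y + forest_sum G' {#opp e2, opp e3#} \<alpha> * x +
      forest_sum G' {#opp e1, opp e3#} \<alpha> * y + forest_sum G' {#opp e1, opp e2, opp e3#} \<alpha>)"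
proof -
  have E: "e1 \<notin> edges G'" "e2 \<notin> edges G'" "e3 \<notin> edges G'" "verts G' \<noteq> {}"
    using e incident_Int_edges_delete_vertex[of G w] incident_ends[of e1] by auto
  have distinct: "e1 \<noteq> e2" "e2 \<noteq> e1" "e1 \<noteq> e3" "e3 \<noteq> e1" "e2 \<noteq> e3" "e3 \<noteq> e2" using e(2) by auto
  have "kirchhoff G (\<alpha>(e1 := x, e2 := y, e3 := z)) = (\<Sum>S\<in>Pow {e1, e2, e3}.
      prod (\<alpha>(e1 := x, e2 := y, e3 := z)) ({e1, e2, e3} - S) *
      forest_sum G' (image_mset opp (mset_set S)) \<alpha>)"
    using E e(1) by (simp add: kirchhoff_eq_forest_sum[OF wf in_verts] forest_sum_root_expansion)
  also have "\<dots> = (kirchhoff G' \<alpha> * (x + y) + forest_sum G' {#opp e1, opp e2#} \<alpha>) * z +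
    (kirchhoff G' \<alpha> * x * y + forest_sum G' {#opp e2, opp e3#} \<alpha> * x +
      forest_sum G' {#opp e1, opp e3#} \<alpha> * y + forest_sum G' {#opp e1, opp e2, opp e3#} \<alpha>)"
    using distinct E(4) e(1)
    by (simp add: sum_Pow_insert insert_Diff_if forest_sum_no_root_eq_0
        kirchhoff_eq_forest_sum_opposite(2)[symmetric] algebra_simps)
  finally show ?thesis .
qed

lemma dvd_sum_common_zeros_degree_2:
  assumes e: "incident G w = {e, e'}" "e \<noteq> e'" and R: "w \<notin># R"
  shows "q dvd (\<Sum>\<alpha>\<in>points q G. zero_mod q (kirchhoff G \<alpha>) * zero_mod q (forest_sum G R \<alpha>))"
proof -
  obtain \<kappa> where \<kappa>: "\<And>\<alpha> x y. forest_sum G R (\<alpha>(e := x, e' := y)) =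
      (x + y) * forest_sum G' R \<alpha> + (\<kappa> \<alpha> :: int)"
    using forest_sum_degree_2[OF e R] by blast
  have "zero_mod q ((s mod q) * m + n) = zero_mod q (s * m + n)" for s m n
    by (intro zero_mod_cong cong_add cong_mult cong_refl) (simp add: cong_def)
  then show ?thesis
    unfolding sum_points_degree_2[OF e] kirchhoff_degree_2[OF e] \<kappa>
    by (intro dvd_sum dvd_sum_pair_periodic[
        where h = "\<lambda>s. zero_mod q (s * _ + _) * zero_mod q (s * _ + _)"]) simp
qed

lemma split_zeros_degree_2:
  assumes q: "prime q" and e: "incident G w = {e, e'}" "e \<noteq> e'" and "b \<noteq> w" "y \<noteq> w"
  shows "[split_zeros q G w b y = split_diff_nonzeros q G' b (opp e') (opp e) y] (mod q)"
proof -
  have "w \<notin># {#y#}" using assms(5) by simp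
  then obtain \<kappa> where \<kappa>: "\<And>\<alpha> x z. split_sum G w {#y#} b (\<alpha>(e := x, e' := z)) =
      z * split_sum G' (opp e) {#y#} b \<alpha> + x * split_sum G' (opp e') {#y#} b \<alpha> + (\<kappa> \<alpha> :: int)"
    using split_sum_degree_2[OF e _ assms(4)] by blast
  show ?thesis
    unfolding split_zeros_def split_diff_nonzeros_def sum_points_degree_2[OF e]
      kirchhoff_degree_2[OF e] \<kappa> split_sum_swap[of G' b]
    by (intro cong_sum sum_pair_affine_cong[where \<epsilon> = 1] zero_mod_cong)
      (simp_all add: sum_affine_zeros_cong[OF q])
qed

text \<open>The right hand side does not involve \<open>y\<close> any more.\<close>

lemma split_diff_nonzeros_degree_2:
  assumes q: "prime q" and e: "incident G w = {e, e'}" "e \<noteq> e'"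
    and V: "y \<in> verts G'" "u \<in> verts G'" "u' \<in> verts G'"
  shows "[split_diff_nonzeros q G w u u' y = (\<Sum>\<alpha>\<in>points q G'. nonzero_mod q (kirchhoff G' \<alpha>) *
    nonzero_mod q (split_sum G' (opp e') {#opp e#} u \<alpha> -
      split_sum G' (opp e') {#opp e#} u' \<alpha>))] (mod q)"
proof -
  let ?s = "\<lambda>d u. split_sum G' (opp d) {#y#} u"
  have not_w: "w \<notin># {#y#}" "u \<noteq> w" "u' \<noteq> w" using V by auto
  obtain \<kappa> where \<kappa>: "\<And>\<alpha> x z. split_sum G w {#y#} u (\<alpha>(e := x, e' := z)) =
      z * ?s e u \<alpha> + x * ?s e' u \<alpha> + (\<kappa> \<alpha> :: int)"
    using split_sum_degree_2[OF e not_w(1,2)] by blast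
  obtain \<kappa>' where \<kappa>': "\<And>\<alpha> x z. split_sum G w {#y#} u' (\<alpha>(e := x, e' := z)) =
      z * ?s e u' \<alpha> + x * ?s e' u' \<alpha> + (\<kappa>' \<alpha> :: int)"
    using split_sum_degree_2[OF e not_w(1,3)] by blast
  have diff: "split_sum G w {#y#} u (\<alpha>(e := x, e' := z)) -
        split_sum G w {#y#} u' (\<alpha>(e := x, e' := z)) =
      z * (?s e u \<alpha> - ?s e u' \<alpha>) + x * (?s e' u \<alpha> - ?s e' u' \<alpha>) + (\<kappa> \<alpha> - \<kappa>' \<alpha>)" for \<alpha> x z
    unfolding \<kappa> \<kappa>' by (simp add: algebra_simps)
  have opp: "opp e' \<in> verts G'" "opp e \<in> verts G'"
    using incident_ends[of e] incident_ends[of e'] e by auto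
  have exchange: "(?s e' u \<alpha> - ?s e' u' \<alpha>) - (?s e u \<alpha> - ?s e u' \<alpha>) =
      split_sum G' (opp e') {#opp e#} u \<alpha> - split_sum G' (opp e') {#opp e#} u' \<alpha>"
    for \<alpha> :: "'e \<Rightarrow> int"
    using split_sum_exchange[OF opp V(1,2), of \<alpha>] split_sum_exchange[OF opp V(1,3), of \<alpha>] by simp
  show ?thesis
    unfolding split_diff_nonzeros_def sum_points_degree_2[OF e] kirchhoff_degree_2[OF e] diff
      exchange[symmetric]
    by (intro cong_sum sum_pair_affine_cong[where \<epsilon> = "- 1"] nonzero_mod_cong)
      (simp_all add: sum_affine_nonzeros_cong[OF q])
qed

lemma split_diff_nonzeros_degree_1:
  assumes q: "prime q" and e: "incident G w = {e}" and "y \<in> verts G'" "u \<noteq> w"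
  shows "[split_diff_nonzeros q G w w u y =
    (\<Sum>\<alpha>\<in>points q G'. - nonzero_mod q (kirchhoff G' \<alpha>))] (mod q)"
proof -
  let ?T = "kirchhoff G'"
  have y: "w \<notin># {#y#}" using assms(3) by auto
  have E: "e \<notin> edges G'" using e incident_Int_edges_delete_vertex[of G w] by blast
  let ?k = "\<lambda>\<alpha>. forest_sum G' {#opp e, y#} \<alpha> - split_sum G' (opp e) {#y#} u \<alpha>"
  have diff: "split_sum G w {#y#} w (\<alpha>(e := x)) - split_sum G w {#y#} u (\<alpha>(e := x)) =
      ?T \<alpha> * x + ?k \<alpha>" for \<alpha> :: "'e \<Rightarrow> int" and x
    using E by (simp add: split_sum_self forest_sum_degree_1(2)[OF e y]
      split_sum_degree_1[OF e y assms(4)] kirchhoff_delete_vertex[OF assms(3)])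
  have T: "kirchhoff G (\<alpha>(e := x)) = ?T \<alpha>" for \<alpha> :: "'e \<Rightarrow> int" and x
    using E by (simp add: kirchhoff_degree_1[OF e] kirchhoff_delete_vertex[OF assms(3)])
  show ?thesis
    unfolding split_diff_nonzeros_def sum_points_degree_1[OF e] diff T
    by (intro cong_sum sum_affine_nonzeros_mult_cong q)
qed

lemma dvd_common_zeros_degree_1:
  assumes q: "prime q" and e: "incident G w = {e}" and b: "b \<in> verts G" "b \<noteq> w" and y: "y \<in> verts G"
  shows "q dvd common_zeros q G w b y"
proof -
  let ?T = "kirchhoff G'"
  have E: "e \<notin> edges G'" using e incident_Int_edges_delete_vertex[of G w] by blast
  have T: "kirchhoff G (\<alpha>(e := x)) = ?T \<alpha>" for \<alpha> :: "'e \<Rightarrow> int" and x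
    using E b by (simp add: kirchhoff_degree_1[OF e] kirchhoff_delete_vertex[of b])
  \<comment> \<open>Where \<open>T\<close> vanishes, no other factor depends on the variable of \<open>e\<close>.\<close>
  have absorb: "zero_mod q t * zero_mod q (x * t + k) = zero_mod q t * zero_mod q k" for t x k
    by (cases "q dvd t") (simp_all add: zero_mod_def dvd_add_right_iff)
  obtain \<phi> where \<phi>: "\<And>\<alpha> x. zero_mod q (?T \<alpha>) * zero_mod q (forest_sum G {#w, y#} (\<alpha>(e := x))) *
      zero_mod q (forest_sum G {#b, y#} (\<alpha>(e := x))) = \<phi> \<alpha>"
  proof (cases "y = w")
    case True
    have "forest_sum G {#b, w#} (\<alpha>(e := x)) = x * ?T \<alpha> + forest_sum G' {#opp e, b#} \<alpha>"
      for \<alpha> :: "'e \<Rightarrow> int" and x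
      using forest_sum_degree_1(2)[OF e, of "{#b#}" "\<alpha>(e := x)"] b E kirchhoff_delete_vertex[of b \<alpha>]
      by (simp add: add_mset_commute)
    then show ?thesis
      using True that by (simp add: forest_sum_repeated_root_eq_0[OF in_verts] absorb)
  next
    case False
    have "forest_sum G {#w, y#} (\<alpha>(e := x)) = x * ?T \<alpha> + forest_sum G' {#opp e, y#} \<alpha>"
      for \<alpha> :: "'e \<Rightarrow> int" and x
      using forest_sum_degree_1(2)[OF e, of "{#y#}" "\<alpha>(e := x)"] y False E
        kirchhoff_delete_vertex[of y \<alpha>] by simp
    moreover have "forest_sum G {#b, y#} (\<alpha>(e := x)) = forest_sum G' {#b, y#} \<alpha>"
      for \<alpha> :: "'e \<Rightarrow> int" and x
      using forest_sum_degree_1(1)[OF e, of "{#b, y#}" "\<alpha>(e := x)"] b False E by simp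
    ultimately show ?thesis using that by (simp add: absorb)
  qed
  have "common_zeros q G w b y = (\<Sum>\<alpha>\<in>points q G'. q * \<phi> \<alpha>)"
    unfolding common_zeros_def sum_points_degree_1[OF e] T \<phi> using prime_gt_0_int[OF q] by simp
  then show ?thesis by (simp add: sum_distrib_left[symmetric])
qed

end

lemma common_zeros_loop:
  assumes wf: "wf_graph G" and V: "a \<in> verts G" "b \<in> verts G" "b \<noteq> a" "y \<in> verts G" "y \<noteq> a"
    and a: "incident G a = {e}" "ends G e = {a}"
  shows "common_zeros q G a b y =
    (\<Sum>\<alpha>\<in>points q G. zero_mod q (\<alpha> e * kirchhoff (delete_vertex G a) \<alpha>))"
proof -
  note loop = forest_sum_loop[OF wf V(1) _ a]
  have "kirchhoff G \<alpha> = 0" "forest_sum G {#b, y#} \<alpha> = 0"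
    "forest_sum G {#a, y#} \<alpha> = \<alpha> e * kirchhoff (delete_vertex G a) \<alpha>" for \<alpha> :: "'b \<Rightarrow> int"
    using V by (auto simp: loop kirchhoff_eq_forest_sum[OF wf V(2)]
        kirchhoff_eq_forest_sum[OF wf_delete_vertex[OF wf], of y])
  then show ?thesis by (simp add: common_zeros_def zero_mod_def)
qed

text \<open>
  If \<open>T\<close> vanishes, then the three-root identity shows that the split sum vanishes iff one of the two
  2-forest sums does; inclusion and exclusion gives the claim.
\<close>

lemma common_zeros_cong_split_zeros:
  assumes q: "prime q" and ab: "a \<noteq> b" and y: "y \<in> verts G" "y \<noteq> a" "y \<noteq> b"
    and a: "loopless_vertex G a" "incident G a = {e, e'}" "e \<noteq> e'"
    and b: "loopless_vertex G b" "incident G b = {d, d'}" "d \<noteq> d'"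
  shows "[common_zeros q G a b y = - split_zeros q G a b y] (mod q)"
proof -
  interpret a: loopless_vertex G a by fact
  interpret b: loopless_vertex G b by fact
  let ?Z = "\<lambda>R \<alpha>. zero_mod q (forest_sum G R \<alpha>)"
  let ?T = "\<lambda>\<alpha>. zero_mod q (kirchhoff G \<alpha>)"
  have "?T \<alpha> * ?Z {#a, y#} \<alpha> * ?Z {#b, y#} \<alpha> =
      ?T \<alpha> * ?Z {#a, y#} \<alpha> + ?T \<alpha> * ?Z {#b, y#} \<alpha> -
      ?T \<alpha> * zero_mod q (split_sum G a {#y#} b \<alpha>)" for \<alpha>
  proof (cases "q dvd kirchhoff G \<alpha>")
    case True
    then have "q dvd forest_sum G {#a, y#} \<alpha> * forest_sum G {#b, y#} \<alpha> -
        (split_sum G a {#y#} b \<alpha>)\<^sup>2"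
      using forest_sum_three_roots[OF a.wf a.in_verts b.in_verts y(1), of \<alpha>]
        kirchhoff_eq_forest_sum[OF a.wf y(1), of \<alpha>] by (metis dvd_mult2)
    then have "q dvd forest_sum G {#a, y#} \<alpha> * forest_sum G {#b, y#} \<alpha> \<longleftrightarrow>
        q dvd (split_sum G a {#y#} b \<alpha>)\<^sup>2"
      by (metis dvd_diff_right_iff dvd_diff_left_iff)
    then have "q dvd forest_sum G {#a, y#} \<alpha> \<or> q dvd forest_sum G {#b, y#} \<alpha> \<longleftrightarrow>
        q dvd split_sum G a {#y#} b \<alpha>"
      using q by (simp add: prime_dvd_mult_iff prime_dvd_power_iff)
    then show ?thesis by (auto simp: zero_mod_def)
  qed (simp add: zero_mod_def)
  then have "common_zeros q G a b y = (\<Sum>\<alpha>\<in>points q G. ?T \<alpha> * ?Z {#a, y#} \<alpha>) +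
      (\<Sum>\<alpha>\<in>points q G. ?T \<alpha> * ?Z {#b, y#} \<alpha>) - split_zeros q G a b y"
    unfolding common_zeros_def split_zeros_def by (simp only: sum.distrib sum_subtractf)
  moreover have "q dvd (\<Sum>\<alpha>\<in>points q G. ?T \<alpha> * ?Z {#a, y#} \<alpha>)"
    using ab y by (intro b.dvd_sum_common_zeros_degree_2[OF b(2,3)]) auto
  moreover have "q dvd (\<Sum>\<alpha>\<in>points q G. ?T \<alpha> * ?Z {#b, y#} \<alpha>)"
    using ab y by (intro a.dvd_sum_common_zeros_degree_2[OF a(2,3)]) auto
  ultimately show ?thesis by (simp add: cong_iff_dvd_diff)
qed

lemma split_diff_nonzeros_cong:
  assumes q: "prime q" and b: "loopless_vertex G b"
    and degree: "degree G b + of_bool (u = b) + of_bool (u' = b) = 2"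
    and V: "u \<in> verts G" "u' \<in> verts G" "x \<in> verts G" "x \<noteq> b" "y \<in> verts G" "y \<noteq> b"
  shows "[split_diff_nonzeros q G b u u' y = split_diff_nonzeros q G b u u' x] (mod q)"
proof -
  interpret loopless_vertex G b by fact
  have leaf: "[split_diff_nonzeros q G b b u y = split_diff_nonzeros q G b b u x] (mod q)"
    if degree_1: "degree G b = 1" and u: "u \<noteq> b" for u
  proof -
    obtain e where e: "incident G b = {e}" by (rule degree_eq_1E[OF wf in_verts degree_1])
    have "y \<in> verts G'" "x \<in> verts G'" using V by auto
    note this[THEN split_diff_nonzeros_degree_1[OF q e _ u]]
    from cong_trans[OF this(1) cong_sym[OF this(2)]] show ?thesis .
  qed
  consider "u = u'" | "u = b" "u' \<noteq> b" | "u' = b" "u \<noteq> b" | "u \<noteq> b" "u' \<noteq> b" by blast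
  then show ?thesis
  proof cases
    case 1
    then show ?thesis by (simp add: split_diff_nonzeros_self)
  next
    case 2
    then show ?thesis using leaf[of u'] degree by simp
  next
    case 3
    then show ?thesis
      using leaf[of u] degree by (simp add: split_diff_nonzeros_commute[of q G b u b])
  next
    case 4
    then obtain e e' where e: "incident G b = {e, e'}" "e \<noteq> e'"
      using degree degree_eq_card_incident by (auto simp: card_2_iff)
    have xy: "y \<in> verts G'" "x \<in> verts G'" and u: "u \<in> verts G'" "u' \<in> verts G'"
      using V 4 by auto
    note xy[THEN split_diff_nonzeros_degree_2[OF q e _ u]]
    from cong_trans[OF this(1) cong_sym[OF this(2)]] show ?thesis .
  qed
qed

lemma split_zeros_cong:
  assumes q: "prime q" and a: "loopless_vertex G a" "degree G a = 2"
    and b: "loopless_vertex G b" "degree G b = 2" and ab: "a \<noteq> b"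
    and V: "x \<in> verts G" "x \<noteq> a" "x \<noteq> b" "y \<in> verts G" "y \<noteq> a" "y \<noteq> b"
  shows "[split_zeros q G a b y = split_zeros q G a b x] (mod q)"
proof -
  interpret a: loopless_vertex G a by fact
  interpret b: loopless_vertex G b by fact
  obtain e e' where e: "incident G a = {e, e'}" "e \<noteq> e'"
    using a(2) a.degree_eq_card_incident by (auto simp: card_2_iff)
  have "degree a.G' b + of_bool (a.opp e' = b) + of_bool (a.opp e = b) = 2"
    using a.degree_delete_vertex[of b] b(2) ab e by (auto simp: neighbour_mset_def split: if_splits)
  moreover have "loopless_vertex a.G' b" using b.delete_other_vertex ab by simp
  ultimately have diff: "[split_diff_nonzeros q a.G' b (a.opp e') (a.opp e) y =
      split_diff_nonzeros q a.G' b (a.opp e') (a.opp e) x] (mod q)"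
    using V a.incident_ends(2,3)[of e] a.incident_ends(2,3)[of e'] e
    by (intro split_diff_nonzeros_cong[OF q]) auto
  note delete = V(5,2)[THEN a.split_zeros_degree_2[OF q e ab[symmetric]]]
  show ?thesis by (rule cong_trans[OF delete(1) cong_trans[OF diff cong_sym[OF delete(2)]]])
qed

lemma common_zeros_cong_degree_2:
  assumes q: "prime q" and wf: "wf_graph G"
    and ab: "a \<in> verts G" "b \<in> verts G" "a \<noteq> b" and degree: "degree G a = 2" "degree G b = 2"
    and x: "x \<in> verts G" "x \<noteq> a" "x \<noteq> b" and y: "y \<in> verts G" "y \<noteq> a" "y \<noteq> b"
  shows "[common_zeros q G a b y = common_zeros q G a b x] (mod q)"
  using wf ab(1) degree(1)
proof (cases rule: degree_eq_2_cases)
  case (loop e)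
  then show ?thesis using common_zeros_loop[OF wf ab(1,2)] ab(3) x y by simp
next
  case a: (edges e e')
  from wf ab(2) degree(2) show ?thesis
  proof (cases rule: degree_eq_2_cases)
    case (loop d)
    then show ?thesis
      using common_zeros_loop[OF wf ab(2,1)] ab(3) x y by (simp add: common_zeros_commute[of q G a])
  next
    case b: (edges d d')
    note split = common_zeros_cong_split_zeros[OF q ab(3) _ _ _ a b]
    have "[- split_zeros q G a b y = - split_zeros q G a b x] (mod q)"
      unfolding cong_minus_minus_iff
      by (rule split_zeros_cong[OF q a(1) degree(1) b(1) degree(2) ab(3) x y])
    from cong_trans[OF cong_trans[OF split[OF y] this] cong_sym[OF split[OF x]]] show ?thesis .
  qed
qed

lemma common_zeros_cong:
  assumes q: "prime q" and wf: "wf_graph G"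
    and ab: "a \<in> verts G" "b \<in> verts G" "a \<noteq> b" and xy: "x \<in> verts G" "y \<in> verts G"
    and degree_a: "degree G a + of_bool (x = a) + of_bool (y = a) = 2"
    and degree_b: "degree G b + of_bool (x = b) + of_bool (y = b) = 2"
  shows "[common_zeros q G a b y = common_zeros q G a b x] (mod q)"
proof -
  have leaf: "q dvd common_zeros q G u u' z"
    if "degree G u = 1" "u \<in> verts G" "u' \<in> verts G" "u' \<noteq> u" "z \<in> verts G" for u u' z
    using that degree_eq_1E[OF wf that(2,1)] loopless_vertex.dvd_common_zeros_degree_1[OF _ q]
    by metis
  consider "x = y" | "x \<noteq> y" "x = a \<or> y = a" | "x \<noteq> y" "x = b \<or> y = b"
    | "x \<noteq> a" "x \<noteq> b" "y \<noteq> a" "y \<noteq> b" by blast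
  then show ?thesis
  proof cases
    case 1
    then show ?thesis by simp
  next
    case 2
    then have "degree G a = 1" using degree_a by auto
    then show ?thesis using leaf ab xy by (simp add: cong_iff_dvd_diff)
  next
    case 3
    then have "degree G b = 1" using degree_b by auto
    then show ?thesis
      using leaf[of b a] ab xy by (simp add: cong_iff_dvd_diff common_zeros_commute[of q G a])
  next
    case 4
    then show ?thesis
      using degree_a degree_b xy by (intro common_zeros_cong_degree_2[OF q wf ab]) simp_all
  qed
qed

section \<open>Point counts of vertex-deleted graphs\<close>

lemma point_count_eq_sum:
  assumes "wf_graph G"
  shows "int (point_count p G) = (\<Sum>\<alpha>\<in>points (int p) G. zero_mod (int p) (kirchhoff G \<alpha>))"
proof -
  have "finite (points (int p) G)" using assms by (auto simp: wf_graph_def intro: finite_PiE)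
  then show ?thesis
    unfolding point_count_def zero_mod_def cong_0_iff
    by (simp only: sum_of_bool_eq Int_def mem_Collect_eq)
qed

lemma image_mset_mset_set_eq_mset:
  assumes "finite A" "image_mset f (mset_set A) = mset xs"
  shows "\<exists>es. distinct es \<and> set es = A \<and> map f es = xs"
  using assms
proof (induction xs arbitrary: A)
  case Nil
  then show ?case by (simp add: mset_set_empty_iff)
next
  case (Cons x xs)
  then obtain N e where N: "mset_set A = add_mset e N" "f e = x" "image_mset f N = mset xs"
    using msed_map_invR[of f "mset_set A" x "mset xs"] by auto
  then have e: "e \<in> A" using Cons.prems(1) by (metis elem_mset_set union_single_eq_member)
  then have "mset_set (A - {e}) = N" using N(1) Cons.prems(1) by (simp add: mset_set_Diff)
  then obtain es where "distinct es" "set es = A - {e}" "map f es = xs"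
    using Cons.IH[of "A - {e}"] Cons.prems(1) N(3) by auto
  then show ?case using e N(2) by (intro exI[of _ "e # es"]) auto
qed

context loopless_vertex
begin

lemma sum_points_degree_3:
  assumes "incident G w = {e1, e2, e3}" "distinct [e1, e2, e3]"
  shows "(\<Sum>\<alpha>\<in>points q G. \<phi> \<alpha>) = (\<Sum>\<alpha>\<in>points q G'.
    \<Sum>x\<in>{0..<q}. \<Sum>y\<in>{0..<q}. \<Sum>z\<in>{0..<q}. \<phi> (\<alpha>(e1 := x, e2 := y, e3 := z)))"
proof -
  have E: "edges G = insert e3 (insert e2 (insert e1 (edges G')))"
      "e3 \<notin> insert e2 (insert e1 (edges G'))" "e2 \<notin> insert e1 (edges G')" "e1 \<notin> edges G'"
    using assms edges_eq_incident_Un[of G w] incident_Int_edges_delete_vertex[of G w] by auto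
  show ?thesis
    unfolding E(1) sum_PiE_insert[OF E(2)] sum_PiE_insert[OF E(3)] sum_PiE_insert[OF E(4)] ..
qed

lemma neighbour_mset_eq_mset:
  assumes "neighbour_mset G w = mset xs"
  shows "\<exists>es. distinct es \<and> incident G w = set es \<and> map opp es = xs"
  using image_mset_mset_set_eq_mset[OF finite_edges(2), of opp xs] assms
  by (auto simp: neighbour_mset_def)

lemma point_count_two_neighbours:
  assumes "neighbour_mset G w = {#a, b#}"
  shows "int (point_count p G) = (\<Sum>\<alpha>\<in>points (int p) G'. \<Sum>x\<in>{0..<int p}. \<Sum>y\<in>{0..<int p}.
    zero_mod (int p) ((x + y) * kirchhoff G' \<alpha> + forest_sum G' {#a, b#} \<alpha>))"
proof -
  obtain e e' where "incident G w = {e, e'}" "e \<noteq> e'" "opp e = a" "opp e' = b"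
    using neighbour_mset_eq_mset[of "[a, b]"] assms by (auto simp: map_eq_Cons_conv)
  then show ?thesis
    by (simp add: point_count_eq_sum[OF wf] sum_points_degree_2 kirchhoff_degree_2)
qed

lemma point_count_three_neighbours:
  assumes p: "prime p" and N: "neighbour_mset G w = {#a, b, y#}"
  obtains k where "int (point_count p G) =
    (int p)\<^sup>2 * (int p ^ card (edges G') - common_zeros (int p) G' a b y + int p * k)"
proof -
  define q where "q = int p"
  have q: "prime q" using p by (simp add: q_def)
  obtain e1 e2 e3 where e: "incident G w = {e1, e2, e3}" "distinct [e1, e2, e3]"
    and opp: "opp e1 = a" "opp e2 = b" "opp e3 = y"
    using neighbour_mset_eq_mset[of "[a, b, y]"] N by (auto simp: map_eq_Cons_conv)
  have V: "a \<in> verts G'" "b \<in> verts G'" "y \<in> verts G'"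
    using incident_ends[of e1] incident_ends[of e2] incident_ends[of e3] e(1) opp by auto
  let ?T = "kirchhoff G'" and ?f = "forest_sum G'"
  let ?Z = "\<lambda>\<alpha>. zero_mod q (?T \<alpha>) * zero_mod q (?f {#a, y#} \<alpha>) * zero_mod q (?f {#b, y#} \<alpha>)"
  have cone: "(\<Sum>x\<in>{0..<q}. \<Sum>y\<in>{0..<q}. \<Sum>z\<in>{0..<q}.
        zero_mod q (kirchhoff G (\<alpha>(e1 := x, e2 := y, e3 := z)))) =
      q\<^sup>2 * (1 - ?Z \<alpha> * (1 - q * zero_mod q (?f {#a, b, y#} \<alpha>)))" for \<alpha>
    unfolding kirchhoff_degree_3[OF e] opp forest_sum_two_roots[OF V] cone_zeros_def[symmetric]
    by (intro cone_zeros_eq[OF q])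
      (simp add: forest_sum_three_roots[OF wf_delete_vertex[OF wf] V, symmetric]
        kirchhoff_delete_vertex[OF V(3)])
  have "int (point_count p G) =
      (\<Sum>\<alpha>\<in>points q G'. q\<^sup>2 * (1 - ?Z \<alpha> + q * (?Z \<alpha> * zero_mod q (?f {#a, b, y#} \<alpha>))))"
    unfolding point_count_eq_sum[OF wf] q_def[symmetric] sum_points_degree_3[OF e] cone
    by (intro sum.cong refl) (simp add: algebra_simps)
  also have "\<dots> = q\<^sup>2 * (q ^ card (edges G') - common_zeros q G' a b y +
      q * (\<Sum>\<alpha>\<in>points q G'. ?Z \<alpha> * zero_mod q (?f {#a, b, y#} \<alpha>)))"
    unfolding common_zeros_def sum_distrib_left[symmetric] sum.distrib sum_subtractf
    using prime_gt_0_int[OF q] finite_edges(1) by (simp add: card_PiE)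
  finally show ?thesis using that unfolding q_def by blast
qed

lemma c2_at_three_neighbours:
  assumes p: "prime p" and "neighbour_mset G w = {#a, b, y#}"
  shows "int (c2_at p G) =
    (int p ^ card (edges G') - common_zeros (int p) G' a b y) mod int p"
proof -
  obtain k where "int (point_count p G) =
    (int p)\<^sup>2 * (int p ^ card (edges G') - common_zeros (int p) G' a b y + int p * k)"
    using point_count_three_neighbours[OF assms] .
  moreover have "(int p)\<^sup>2 \<noteq> 0" using prime_gt_0_nat[OF p] by simp
  ultimately show ?thesis by (simp add: c2_at_def of_nat_mod of_nat_div)
qed

end

lemma neighbours_subset_verts: "wf_graph G \<Longrightarrow> neighbours G v \<subseteq> verts G"
  using ends_subset_verts[of G] by (fastforce simp: neighbours_def)

lemma four_neighbours:
  assumes wf: "wf_graph G" and V: "v \<in> verts G" and degree: "degree G v = 4"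
    and N: "{a, b, c} \<subseteq> neighbours G v" "distinct [a, b, c]"
  obtains x where "loopless_vertex G v" "neighbour_mset G v = {#a, b, c, x#}"
proof -
  let ?loops = "{e \<in> edges G. ends G e = {v}}"
  have "\<forall>u\<in>{a, b, c}. \<exists>e\<in>edges G. ends G e = {v, u}" and v: "v \<notin> {a, b, c}"
    using N(1) by (auto simp: neighbours_def)
  then obtain f where f: "f u \<in> edges G" "ends G (f u) = {v, u}" if "u \<in> {a, b, c}" for u by metis
  have "inj_on f {a, b, c}"
    using f(2) by (intro inj_onI) (metis doubleton_eq_iff)
  then have "card (f ` {a, b, c}) = 3" using N(2) by (simp add: card_image)
  moreover have "card (f ` {a, b, c} \<union> ?loops) = card (f ` {a, b, c}) + card ?loops"
    using wf f v by (intro card_Un_disjoint) (auto simp: wf_graph_def)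
  moreover have "card (f ` {a, b, c} \<union> ?loops) \<le> card (incident G v)"
    using f finite_incident[OF wf] by (intro card_mono) (auto simp: incident_def)
  ultimately have "card ?loops = 0" using degree by (simp add: degree_def incident_def)
  then interpret loopless_vertex G v using wf V by unfold_locales (auto simp: wf_graph_def)
  have "u \<in># neighbour_mset G v" if "u \<in> {a, b, c}" for u
    using f[OF that] opposite_eq[OF f(2)[OF that]] finite_edges(2)
    by (force simp: neighbour_mset_def incident_def)
  then have "{#a, b, c#} \<subseteq># neighbour_mset G v"
    using N(2) by (auto simp: subseteq_mset_def Suc_le_eq)
  then obtain M where M: "neighbour_mset G v = {#a, b, c#} + M" by (metis subset_mset.le_iff_add)
  moreover have "size (neighbour_mset G v) = 4"
    using degree degree_eq_card_incident by (simp add: neighbour_mset_def)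
  ultimately have "size M = 1" by simp
  then obtain x where "M = {#x#}" using size_1_singleton_mset by blast
  then show ?thesis using M that loopless_vertex_axioms by simp
qed

lemma count_neighbour_mset_commute:
  assumes "loopless_vertex G v" "loopless_vertex G w"
  shows "count (neighbour_mset G v) w = count (neighbour_mset G w) v"
proof -
  interpret v: loopless_vertex G v by fact
  interpret w: loopless_vertex G w by fact
  have "{e \<in> incident G v. v.opp e = w} = {e \<in> edges G. ends G e = {v, w}}"
    using v.incident_ends(1) opposite_eq[of G _ v w] by (auto simp: incident_def)
  moreover have "{e \<in> incident G w. w.opp e = v} = {e \<in> edges G. ends G e = {w, v}}"
    using w.incident_ends(1) opposite_eq[of G _ w v] by (auto simp: incident_def)
  ultimately show ?thesis
    by (simp add: v.count_neighbour_mset w.count_neighbour_mset insert_commute)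
qed

lemma degree_delete_two_vertices:
  assumes "loopless_vertex G v" "loopless_vertex G w" "v \<noteq> w" "u \<noteq> v" "u \<noteq> w"
  shows "degree G u = degree (delete_vertex (delete_vertex G v) w) u +
    count (neighbour_mset G v) u + count (neighbour_mset G w) u"
  using loopless_vertex.degree_delete_vertex[OF assms(1), of u]
    loopless_vertex.degree_delete_vertex[
      OF loopless_vertex.delete_other_vertex[OF assms(2,3)], of u]
    loopless_vertex.neighbour_mset_delete_vertex[OF assms(2), of v] assms(3-5)
  by simp

lemma point_count_delete_vertex_double_edge:
  assumes "loopless_vertex G v" "loopless_vertex G w" "v \<noteq> w"
    and "neighbour_mset G v = {#w, a, b, w#}" "neighbour_mset G w = {#v, a, b, v#}"
    and "{a, b} \<inter> {v, w} = {}"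
  shows "point_count p (delete_vertex G v) = point_count p (delete_vertex G w)"
proof -
  interpret v: loopless_vertex "delete_vertex G w" v
    using loopless_vertex.delete_other_vertex[OF assms(1)] assms(3) by simp
  interpret w: loopless_vertex "delete_vertex G v" w
    using loopless_vertex.delete_other_vertex[OF assms(2)] assms(3) by simp
  have "neighbour_mset (delete_vertex G w) v = {#a, b#}"
    "neighbour_mset (delete_vertex G v) w = {#a, b#}"
    using loopless_vertex.neighbour_mset_delete_vertex[OF assms(1), of w]
      loopless_vertex.neighbour_mset_delete_vertex[OF assms(2), of v] assms(3-6) by auto
  then have "int (point_count p (delete_vertex G v)) = int (point_count p (delete_vertex G w))"
    by (simp add: v.point_count_two_neighbours w.point_count_two_neighbours
        delete_vertex_commute[of G v w])
  then show ?thesis by simp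
qed

lemma c2_at_delete_vertex_simple_edge:
  assumes p: "prime p" and v: "loopless_vertex G v" and w: "loopless_vertex G w"
    and ne: "v \<noteq> w" "a \<noteq> b" "{a, b} \<inter> {v, w} = {}" "x \<noteq> w" "y \<noteq> v"
    and N: "neighbour_mset G v = {#w, a, b, x#}" "neighbour_mset G w = {#v, a, b, y#}"
    and degree: "degree G a = 4" "degree G b = 4"
  shows "c2_at p (delete_vertex G v) = c2_at p (delete_vertex G w)"
proof -
  interpret v: loopless_vertex "delete_vertex G w" v
    using loopless_vertex.delete_other_vertex[OF v] ne(1) by simp
  interpret w: loopless_vertex "delete_vertex G v" w
    using loopless_vertex.delete_other_vertex[OF w] ne(1) by simp
  have K: "v.G' = w.G'" by (rule delete_vertex_commute)
  have Nv: "neighbour_mset (delete_vertex G w) v = {#a, b, x#}"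
    and Nw: "neighbour_mset (delete_vertex G v) w = {#a, b, y#}"
    using loopless_vertex.neighbour_mset_delete_vertex[OF v, of w]
      loopless_vertex.neighbour_mset_delete_vertex[OF w, of v] N ne by auto
  have V: "a \<in> verts w.G'" "b \<in> verts w.G'" "x \<in> verts w.G'" "y \<in> verts w.G'"
    using v.neighbour_mset_in_verts w.neighbour_mset_in_verts Nv Nw K by auto
  have "degree w.G' u + of_bool (x = u) + of_bool (y = u) = 2" if u: "u \<in> {a, b}" for u
  proof -
    have "count (neighbour_mset G v) u = 1 + of_bool (x = u)"
      "count (neighbour_mset G w) u = 1 + of_bool (y = u)"
      using u ne unfolding N by auto
    moreover have "u \<noteq> v" "u \<noteq> w" "degree G u = 4" using u ne(3) degree by auto
    ultimately show ?thesis using degree_delete_two_vertices[OF v w ne(1), of u] by simp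
  qed
  then have "[common_zeros (int p) w.G' a b y = common_zeros (int p) w.G' a b x] (mod int p)"
    by (intro common_zeros_cong[OF _ wf_delete_vertex[OF w.wf] V(1,2) ne(2) V(3,4)])
      (use p in simp_all)
  from cong_diff[OF cong_refl this, of "int p ^ card (edges w.G')"]
  have "int (c2_at p (delete_vertex G v)) = int (c2_at p (delete_vertex G w))"
    using w.c2_at_three_neighbours[OF p Nw] v.c2_at_three_neighbours[OF p Nv]
    unfolding K cong_def by simp
  then show ?thesis by simp
qed

lemma c2_at_delete_vertex:
  assumes wf: "wf_graph G" and reg: "regular_graph 4 G" and p: "prime p"
    and v: "v \<in> verts G" and w: "w \<in> verts G" and vw: "w \<in> neighbours G v"
    and two: "card (neighbours G v \<inter> neighbours G w) = 2"
  shows "c2_at p (delete_vertex G v) = c2_at p (delete_vertex G w)"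
proof -
  obtain a b where ab: "neighbours G v \<inter> neighbours G w = {a, b}" "a \<noteq> b"
    using two by (auto simp: card_2_iff)
  then have "a \<in> verts G" "b \<in> verts G" using neighbours_subset_verts[OF wf, of v] by auto
  then have degree: "degree G u = 4" if "u \<in> {v, w, a, b}" for u
    using reg v w that by (auto simp: regular_graph_def)
  have wv: "v \<in> neighbours G w" using vw by (auto simp: neighbours_def insert_commute)
  have ne: "{a, b} \<inter> {v, w} = {}" "v \<noteq> w" using ab(1) vw by (auto simp: neighbours_def)
  obtain x where x: "loopless_vertex G v" "neighbour_mset G v = {#w, a, b, x#}"
    by (rule four_neighbours[OF wf v degree, of w a b]) (use ab vw ne in auto)
  obtain y where y: "loopless_vertex G w" "neighbour_mset G w = {#v, a, b, y#}"
    by (rule four_neighbours[OF wf w degree, of v a b]) (use ab wv ne in auto)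
  have double: "x = w \<longleftrightarrow> y = v"
    using count_neighbour_mset_commute[OF x(1) y(1)] x(2) y(2) ne by (auto split: if_splits)
  show ?thesis
  proof (cases "x = w")
    case True
    then show ?thesis
      using point_count_delete_vertex_double_edge[OF x(1) y(1) ne(2)] x(2) y(2) double ne
      by (simp add: c2_at_def)
  next
    case False
    then show ?thesis
      using double degree
        c2_at_delete_vertex_simple_edge[OF p x(1) y(1) ne(2) ab(2) ne(1) _ _ x(2) y(2)]
      by simp
  qed
qed

theorem theorem7p10:
  fixes G :: "('v, 'e) multigraph" and v w :: 'v and p :: nat
  assumes "wf_graph G"
    and "connected_graph G"
    and "regular_graph 4 G"
    and "prime p"
    and "v \<in> verts G" and "w \<in> verts G"
    and "w \<in> neighbours G v"
    and "card (neighbours G v \<inter> neighbours G w) = 2"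
  shows "c2_at p (delete_vertex G v) = c2_at p (delete_vertex G w) \<and>
         c2 (delete_vertex G v) = c2 (delete_vertex G w)"
  using c2_at_delete_vertex[OF assms(1,3) _ assms(5-8)] assms(4)
  by (auto simp: c2_def restrict_def fun_eq_iff)

end
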